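(* There exists a constant $c > 0$ such that the following holds. Let $G$ be an $r$-regular graph on $n$ vertices, $r = r(n)$. Then $G \cup \mathbb{G}(n,p)$ is a.a.s. Hamiltonian whenever $p := p(n) \geq \min\left\{\frac{(1+o(1))\log n}{n}, \frac{c\sqrt{n^3 \log n}}{r^3}\right\}$.
   Context: For an $n$-vertex graph $G$, $G \cup \mathbb{G}(n,p)$ denotes the union $G \cup R$ where $R$ is the binomial random graph on the vertex set $V(G)$ in which each pair of vertices is an edge independently with probability $p$. "A.a.s." means with probability tending to $1$ as $n \to \infty$. A graph is Hamiltonian if it has a cycle through all its vertices. *)

theory Defs
  imports Complex_Main
begin

definition all_pairs :: "nat \<Rightarrow> nat set set" where
  "all_pairs n = {e. e \<subseteq> {..<n} \<and> card e = 2}"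

definition regular_graph :: "nat \<Rightarrow> nat \<Rightarrow> nat set set \<Rightarrow> bool" where
  "regular_graph n r E \<longleftrightarrow> E \<subseteq> all_pairs n \<and> (\<forall>v<n. card {e\<in>E. v \<in> e} = r)"

definition hamiltonian :: "nat \<Rightarrow> nat set set \<Rightarrow> bool" where
  "hamiltonian n E \<longleftrightarrow> (\<exists>vs. distinct vs \<and> set vs = {..<n} \<and> length vs \<ge> 3 \<and>
      (\<forall>i<length vs. {vs ! i, vs ! ((i + 1) mod length vs)} \<in> E))"

definition prob_gnp :: "nat \<Rightarrow> real \<Rightarrow> (nat set set \<Rightarrow> bool) \<Rightarrow> real" where
  "prob_gnp n p Q = (\<Sum>R\<in>{R. R \<subseteq> all_pairs n \<and> Q R}.
      p ^ card R * (1 - p) ^ (card (all_pairs n) - card R))"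

text \<open>The threshold min{(1+eps n) log n / n, c sqrt(n^3 log n)/r^3}; for r = 0 the
  second term is +infinity.\<close>

definition ham_threshold :: "real \<Rightarrow> real \<Rightarrow> nat \<Rightarrow> nat \<Rightarrow> real" where
  "ham_threshold c e n r =
     (if r = 0 then (1 + e) * ln (real n) / real n
      else min ((1 + e) * ln (real n) / real n)
               (c * sqrt (real n ^ 3 * ln (real n)) / real r ^ 3))"

end

theory Submission
  imports Defs "HOL-Real_Asymp.Real_Asymp" "HOL-Analysis.Convex"
begin

text \<open>
  A Hamilton cycle is approached through orderings of the vertices that have few defects, i.e.
  consecutive non-adjacent pairs. If the cyclic ordering has a defect, open it there and perform Posa
  rotations at both ends: if each end can be rotated into \<open>u\<close> places, at least \<open>u^2 / 2\<close> pairs of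
  vertices are boosters, whose addition lowers the minimal number of defects. A graph that starts with
  \<open>D\<close> defects and stays non-Hamiltonian therefore contains at most \<open>D\<close> random edges after which all
  boosters are missed; a union bound over these edge sets shows that this is unlikely as soon as
  \<open>p u^2\<close> exceeds \<open>D log (n^2 p / D)\<close>.

  In an \<open>r\<close>-regular graph one rotation gives \<open>u = r\<close>, and \<open>D = O (n / sqrt r)\<close>: paths are merged in
  pairs by matching half of their ends to the other half, the halves being chosen such that all
  degrees are nearly halved in mean square. With \<open>N\<close> paths and end degrees about \<open>d\<close> a merging round
  leaves \<open>O (N / sqrt d)\<close> pairs unmatched, which decays geometrically since both \<open>N\<close> and \<open>d\<close> halve.
  For \<open>p\<close> above \<open>(1 + o(1)) log n / n\<close> the random graph alone suffices: a first exposure is an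
  expander, so that \<open>u \<ge> n / 4\<close> by Posa's lemma, and a second exposure with \<open>400 / n\<close> provides the
  boosters.
\<close>

section \<open>Matchings in almost regular bipartite graphs\<close>

text \<open>The trivial bound of \<open>n\<close> defects is too weak: the booster count then needs
  \<open>p r^2\<close> to exceed \<open>n\<close>, but at the second threshold \<open>p r^2\<close>
  has order \<open>n^(3/2) sqrt (log n) / r\<close>, and that threshold is the smaller one only for
  \<open>r\<close> of order at least \<open>n^(5/6)\<close> up to logarithms. Saving a factor
  \<open>sqrt r\<close> in \<open>D\<close> reduces the condition to
  \<open>log (n / r) + log log n = O (sqrt (n log n / r))\<close>, which holds for all
  \<open>r \<le> n\<close>. The obstacle in the merging is to keep the degrees between path ends
  under control for about \<open>log2 (sqrt r)\<close> rounds in a graph of which only regularity is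
  known. The only quantity carried along is the sum of squared deviations of these degrees from
  their target, over both ends. Halving a degree divides its squared deviation by four, but the
  allowed total, proportional to the number of paths times the degree, shrinks by four as well,
  which leaves no room for the fluctuations caused by the splitting. The room comes from always
  consuming the kind of end with the larger sum, so that at most half of the total is passed
  on.\<close>

lemma hall_marriage:
  fixes A :: "'a \<Rightarrow> 'b set"
  assumes "finite I" "\<And>i. i \<in> I \<Longrightarrow> finite (A i)"
    and "\<And>J. J \<subseteq> I \<Longrightarrow> card J \<le> card (\<Union>(A ` J))"
  shows "\<exists>f. inj_on f I \<and> (\<forall>i\<in>I. f i \<in> A i)"
  using assms
proof (induction "card I" arbitrary: I A rule: less_induct)
  case less
  note fin = less.prems(1) and finA = less.prems(2) and hall = less.prems(3)
  have finU: "finite (\<Union>(A ` J))" if "J \<subseteq> I" for J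
    using that fin finA by (meson finite_UN_I finite_subset subsetD)
  show ?case
  proof (cases "I = {}")
    case True
    then show ?thesis by simp
  next
    case ne: False
    \<comment> \<open>A tight proper subset \<open>J\<close> is matched on its own and the rest
      outside its neighbourhood, where Hall's condition survives because \<open>J\<close> accounts
      for at most \<open>card J\<close> elements. Without such a subset every proper nonempty union
      has an element to spare, so any one value may be given away.\<close>
    show ?thesis
    proof (cases "\<exists>J. J \<subset> I \<and> J \<noteq> {} \<and> card (\<Union>(A ` J)) \<le> card J")
      case True
      then obtain J where J: "J \<subset> I" "J \<noteq> {}" "card (\<Union>(A ` J)) \<le> card J"
        by blast
      let ?U = "\<Union>(A ` J)"
      have finJ: "finite J" using J fin finite_subset by blast
      have "card J < card I" using J fin psubset_card_mono by blast
      then obtain f where f: "inj_on f J" "\<forall>i\<in>J. f i \<in> A i"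
        using less.hyps[of J A] finJ finA hall J(1) by (metis order.trans psubset_imp_subset subsetD)
      have "card (I - J) < card I"
        using J fin by (metis Diff_subset double_diff psubsetI psubset_card_mono psubset_imp_subset Diff_cancel)
      moreover have "card K \<le> card (\<Union>((\<lambda>i. A i - ?U) ` K))" if K: "K \<subseteq> I - J" for K
      proof -
        have KI: "finite K" using K fin finite_subset by blast
        have "card K + card J = card (K \<union> J)"
          using K KI finJ by (subst card_Un_disjoint) auto
        also have "\<dots> \<le> card (\<Union>(A ` (K \<union> J)))"
          using K J by (intro hall) auto
        also have "\<Union>(A ` (K \<union> J)) = \<Union>((\<lambda>i. A i - ?U) ` K) \<union> ?U"
          by auto
        also have "card \<dots> \<le> card (\<Union>((\<lambda>i. A i - ?U) ` K)) + card ?U"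
          by (rule card_Un_le)
        finally show ?thesis using J(3) by simp
      qed
      ultimately obtain g where g: "inj_on g (I - J)" "\<forall>i\<in>I - J. g i \<in> A i - ?U"
        using less.hyps[of "I - J" "\<lambda>i. A i - ?U"] fin finA by (metis (no_types, lifting) Diff_iff finite_Diff)
      define k where "k i = (if i \<in> J then f i else g i)" for i
      have "inj_on k I"
      proof (rule inj_onI)
        fix a b assume ab: "a \<in> I" "b \<in> I" "k a = k b"
        show "a = b"
        proof (cases "a \<in> J \<longleftrightarrow> b \<in> J")
          case True
          then show ?thesis using ab f g unfolding k_def inj_on_def by (auto split: if_splits)
        next
          case False
          have "k i \<in> ?U \<longleftrightarrow> i \<in> J" if "i \<in> I" for i
            using that f(2) g(2) unfolding k_def by (cases "i \<in> J") auto
          then show ?thesis using ab False by metis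
        qed
      qed
      moreover have "\<forall>i\<in>I. k i \<in> A i" using f g by (auto simp: k_def)
      ultimately show ?thesis by blast
    next
      case False
      then have strict: "card J < card (\<Union>(A ` J))" if "J \<subset> I" "J \<noteq> {}" for J
        using that by (meson not_le)
      obtain i where i: "i \<in> I" using ne by blast
      have "card {i} \<le> card (\<Union>(A ` {i}))" using i by (intro hall) auto
      then obtain x where x: "x \<in> A i" by (cases "A i = {}") auto
      have "card K \<le> card (\<Union>((\<lambda>j. A j - {x}) ` K))" if K: "K \<subseteq> I - {i}" for K
      proof (cases "K = {}")
        case False
        have "card K < card (\<Union>(A ` K))" using K i False by (intro strict) auto
        also have "\<Union>(A ` K) \<subseteq> insert x (\<Union>((\<lambda>j. A j - {x}) ` K))" by auto
        then have "card (\<Union>(A ` K)) \<le> card (insert x (\<Union>((\<lambda>j. A j - {x}) ` K)))"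
          using finU[of K] K by (intro card_mono) (auto intro: finite_subset[of _ "\<Union>(A ` K)"])
        also have "\<dots> \<le> Suc (card (\<Union>((\<lambda>j. A j - {x}) ` K)))"
          by (rule card_insert_le_m1) auto
        finally show ?thesis by simp
      qed simp
      moreover have "card (I - {i}) < card I" using i fin by (rule card_Diff1_less[rotated])
      ultimately obtain g where g: "inj_on g (I - {i})" "\<forall>j\<in>I - {i}. g j \<in> A j - {x}"
        using less.hyps[of "I - {i}" "\<lambda>j. A j - {x}"] fin finA
        by (metis (no_types, lifting) Diff_iff finite_Diff)
      have "inj_on (g(i := x)) I" using g unfolding inj_on_def by auto
      moreover have "\<forall>j\<in>I. (g(i := x)) j \<in> A j" using g x by auto
      ultimately show ?thesis by blast
    qed
  qed
qed

text \<open>Adding \<open>t\<close> common dummy elements to every \<open>A i\<close> restores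
  Hall's condition; at most \<open>t\<close> indices can be matched to dummies, and these form
  \<open>I - K\<close>.\<close>

lemma hall_deficiency:
  fixes A :: "'a \<Rightarrow> 'b set"
  assumes fin: "finite I" "\<And>i. i \<in> I \<Longrightarrow> finite (A i)"
    and def: "\<And>J. J \<subseteq> I \<Longrightarrow> card J \<le> card (\<Union>(A ` J)) + t"
  shows "\<exists>f K. K \<subseteq> I \<and> card (I - K) \<le> t \<and> inj_on f K \<and> (\<forall>i\<in>K. f i \<in> A i)"
proof -
  define A' where "A' i = (Inl ` A i \<union> Inr ` {..<t} :: ('b + nat) set)" for i
  have "\<exists>f. inj_on f I \<and> (\<forall>i\<in>I. f i \<in> A' i)"
  proof (rule hall_marriage)
    fix J assume J: "J \<subseteq> I"
    show "card J \<le> card (\<Union>(A' ` J))"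
    proof (cases "J = {}")
      case False
      then have eq: "\<Union>(A' ` J) = Inl ` (\<Union>(A ` J)) \<union> Inr ` {..<t}" by (auto simp: A'_def)
      have "finite (\<Union>(A ` J))" using J fin by (meson finite_UN_I finite_subset subsetD)
      then have "card (\<Union>(A' ` J)) = card (\<Union>(A ` J)) + t"
        unfolding eq by (subst card_Un_disjoint) (auto simp: card_image)
      then show ?thesis using def[OF J] by simp
    qed simp
  qed (use fin in \<open>auto simp: A'_def\<close>)
  then obtain f where f: "inj_on f I" "\<And>i. i \<in> I \<Longrightarrow> f i \<in> A' i" by blast
  define K where "K = {i\<in>I. isl (f i)}"
  have "f ` (I - K) \<subseteq> Inr ` {..<t}" using f(2) by (fastforce simp: K_def A'_def)
  then have "card (f ` (I - K)) \<le> card (Inr ` {..<t} :: ('b + nat) set)" by (intro card_mono) auto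
  moreover have "inj_on f (I - K)" using f(1) by (rule inj_on_subset) auto
  ultimately have "card (I - K) \<le> t" by (simp add: card_image)
  moreover have "inj_on (projl \<circ> f) K"
  proof (rule inj_onI)
    fix a b assume "a \<in> K" "b \<in> K" "(projl \<circ> f) a = (projl \<circ> f) b"
    then have "f a = f b" "a \<in> I" "b \<in> I" by (auto simp: K_def) (metis sum.collapse(1))
    then show "a = b" using f(1) by (simp add: inj_on_def)
  qed
  moreover have "\<forall>i\<in>K. (projl \<circ> f) i \<in> A i" using f(2) by (fastforce simp: K_def A'_def)
  ultimately show ?thesis by (metis (no_types, lifting) K_def mem_Collect_eq subsetI)
qed

lemma card_edges_swap:
  assumes "finite J" "finite K"
  shows "(\<Sum>a\<in>J. card {b\<in>K. R a b}) = (\<Sum>b\<in>K. card {a\<in>J. R a b})"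
  by (rule sum_multicount_gen) (use assms in auto)

text \<open>Counting the edges at \<open>S\<close> from both sides bounds
  \<open>(card S - card ?N) * d\<close>, with \<open>?N\<close> the neighbourhood of
  \<open>S\<close>, by the total absolute deviation \<open>D\<close> of the degrees. Hence the Hall
  deficiency is at most \<open>D / d\<close>, and Cauchy-Schwarz passes from \<open>D\<close> to the
  quadratic deviation. The unmatched vertices are paired arbitrarily, at the price of the counted
  non-edges.\<close>

lemma almost_regular_bijection:
  fixes R :: "'a \<Rightarrow> 'a \<Rightarrow> bool"
  assumes fin: "finite I" "finite J" and card: "card I = card J" and disj: "I \<inter> J = {}"
    and d: "d > 0"
    and V: "(\<Sum>a\<in>I. (real (card {b\<in>J. R a b}) - d)\<^sup>2) + (\<Sum>b\<in>J. (real (card {a\<in>I. R a b}) - d)\<^sup>2) \<le> V"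
  shows "\<exists>f. bij_betw f I J \<and> real (card {a\<in>I. \<not> R a (f a)}) \<le> sqrt (2 * real (card I) * V) / d"
proof -
  define p where "p a = real (card {b\<in>J. R a b})" for a
  define q where "q b = real (card {a\<in>I. R a b})" for b
  define D where "D = (\<Sum>a\<in>I. \<bar>p a - d\<bar>) + (\<Sum>b\<in>J. \<bar>q b - d\<bar>)"
  define w where "w a = (if a \<in> I then \<bar>p a - d\<bar> else \<bar>q a - d\<bar>)" for a
  have D_w: "D = (\<Sum>a\<in>I \<union> J. w a)"
    unfolding D_def using fin disj
    by (subst sum.union_disjoint) (auto simp: w_def intro!: sum.cong)
  have w2: "(\<Sum>a\<in>I \<union> J. (w a)\<^sup>2) = (\<Sum>a\<in>I. (p a - d)\<^sup>2) + (\<Sum>b\<in>J. (q b - d)\<^sup>2)"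
    using fin disj
    by (subst sum.union_disjoint) (auto simp: w_def intro!: sum.cong arg_cong2[where f = "(+)"])
  have "D\<^sup>2 \<le> (\<Sum>a\<in>I \<union> J. (w a)\<^sup>2) * real (card (I \<union> J))"
    unfolding D_w by (rule sum_squared_le_sum_of_squares)
  also have "\<dots> \<le> V * real (card (I \<union> J))"
    using V unfolding w2 p_def q_def by (intro mult_right_mono) auto
  also have "card (I \<union> J) = 2 * card I" using fin disj card by (simp add: card_Un_disjoint)
  finally have "D\<^sup>2 \<le> 2 * real (card I) * V" by (simp add: mult_ac)
  then have D_le: "D \<le> sqrt (2 * real (card I) * V)" by (rule real_le_rsqrt)
  have D0: "D \<ge> 0" unfolding D_def by (intro add_nonneg_nonneg sum_nonneg) auto
  define t where "t = nat \<lfloor>D / d\<rfloor>"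
  have t: "real t \<le> D / d" using D0 d by (simp add: t_def)
  have "\<exists>f K. K \<subseteq> I \<and> card (I - K) \<le> t \<and> inj_on f K \<and> (\<forall>i\<in>K. f i \<in> {b\<in>J. R i b})"
  proof (rule hall_deficiency)
    fix S assume S: "S \<subseteq> I"
    let ?N = "\<Union>a\<in>S. {b\<in>J. R a b}"
    have finS: "finite S" using S fin finite_subset by blast
    have finN: "finite ?N" using fin by (intro finite_subset[of ?N J]) auto
    have NJ: "?N \<subseteq> J" by auto
    have "(\<Sum>a\<in>S. p a) = real (\<Sum>a\<in>S. card {b\<in>?N. R a b})"
      unfolding p_def of_nat_sum by (intro sum.cong refl arg_cong[where f = real] arg_cong[where f = card]) auto
    also have "(\<Sum>a\<in>S. card {b\<in>?N. R a b}) = (\<Sum>b\<in>?N. card {a\<in>S. R a b})"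
      using finS finN by (rule card_edges_swap)
    also have "real \<dots> \<le> (\<Sum>b\<in>?N. q b)"
      unfolding q_def of_nat_sum using S fin by (intro sum_mono of_nat_mono card_mono) auto
    finally have le: "(\<Sum>a\<in>S. p a) \<le> (\<Sum>b\<in>?N. q b)" .
    have "real (card S) * d - real (card ?N) * d
        = (\<Sum>a\<in>S. d - p a) + (\<Sum>a\<in>S. p a) - (\<Sum>b\<in>?N. q b) + (\<Sum>b\<in>?N. q b - d)"
      by (simp add: sum_subtractf)
    also have "\<dots> \<le> (\<Sum>a\<in>S. d - p a) + (\<Sum>b\<in>?N. q b - d)" using le by simp
    also have "(\<Sum>a\<in>S. d - p a) \<le> (\<Sum>a\<in>S. \<bar>p a - d\<bar>)" by (intro sum_mono) auto
    also have "\<dots> \<le> (\<Sum>a\<in>I. \<bar>p a - d\<bar>)" using S fin by (intro sum_mono2) auto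
    also have "(\<Sum>b\<in>?N. q b - d) \<le> (\<Sum>b\<in>?N. \<bar>q b - d\<bar>)" by (intro sum_mono) auto
    also have "\<dots> \<le> (\<Sum>b\<in>J. \<bar>q b - d\<bar>)" using NJ fin by (intro sum_mono2) auto
    finally have "(real (card S) - real (card ?N)) * d \<le> D" by (simp add: D_def algebra_simps)
    then have "real (card S) - real (card ?N) \<le> D / d" using d by (simp add: field_simps)
    then have "int (card S) - int (card ?N) \<le> \<lfloor>D / d\<rfloor>" by (simp add: le_floor_iff)
    then show "card S \<le> card ?N + t" by (simp add: t_def)
  qed (use fin in auto)
  then obtain f K where K: "K \<subseteq> I" "card (I - K) \<le> t" "inj_on f K" "\<And>i. i \<in> K \<Longrightarrow> f i \<in> J \<and> R i (f i)"
    by blast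
  have "finite K" using K(1) fin finite_subset by blast
  have fK: "f ` K \<subseteq> J" using K(4) by auto
  have "card (I - K) = card (J - f ` K)"
    using K fK fin \<open>finite K\<close> card by (simp add: card_Diff_subset card_image)
  then obtain g where g: "bij_betw g (I - K) (J - f ` K)"
    using fin by (meson finite_Diff finite_same_card_bij)
  have "bij_betw (\<lambda>i. if i \<in> K then f i else g i) (K \<union> (I - K)) (f ` K \<union> (J - f ` K))"
  proof (rule bij_betw_combine)
    show "bij_betw (\<lambda>i. if i \<in> K then f i else g i) K (f ` K)"
      using K(3) by (simp add: bij_betw_def inj_on_def)
    show "bij_betw (\<lambda>i. if i \<in> K then f i else g i) (I - K) (J - f ` K)"
      using g by (rule bij_betw_cong[THEN iffD1, rotated]) auto
  qed auto
  moreover have "K \<union> (I - K) = I" "f ` K \<union> (J - f ` K) = J" using K(1) fK by auto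
  ultimately have bij: "bij_betw (\<lambda>i. if i \<in> K then f i else g i) I J" by simp
  have "card {a\<in>I. \<not> R a (if a \<in> K then f a else g a)} \<le> card (I - K)"
    using K(4) fin by (intro card_mono) auto
  then have "real (card {a\<in>I. \<not> R a (if a \<in> K then f a else g a)}) \<le> D / d"
    using K(2) t by linarith
  also have "\<dots> \<le> sqrt (2 * real (card I) * V) / d" using D_le d by (intro divide_right_mono) auto
  finally show ?thesis using bij by (intro exI[of _ "\<lambda>i. if i \<in> K then f i else g i"]) auto
qed

section \<open>Balanced splittings\<close>

definition side_sign :: "'a set \<Rightarrow> 'a \<Rightarrow> real" where
  "side_sign I a = (if a \<in> I then 1 else -1)"

lemma quadratic_form_insert2:
  fixes f :: "'a \<Rightarrow> 'a \<Rightarrow> real"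
  assumes "finite B" "a \<notin> B" "b \<notin> B" "a \<noteq> b"
  shows "(\<Sum>x\<in>insert a (insert b B). \<Sum>y\<in>insert a (insert b B). f x y)
    = f a a + f b b + (f a b + f b a) + (\<Sum>c\<in>B. f a c + f c a) + (\<Sum>c\<in>B. f b c + f c b)
      + (\<Sum>x\<in>B. \<Sum>y\<in>B. f x y)"
  using assms by (simp add: sum.distrib)

text \<open>Derandomised version of choosing one element of each pair of a perfect pairing by a fair coin:
  the expectation of the quadratic form is its trace, up to the correlation inside the pairs.\<close>
lemma balanced_signs:
  fixes M :: "'a \<Rightarrow> 'a \<Rightarrow> real"
  assumes "finite A" "card A = 2 * h"
    and "\<And>a b. a \<in> A \<Longrightarrow> b \<in> A \<Longrightarrow> a \<noteq> b \<Longrightarrow> - (w a + w b) \<le> M a b + M b a"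
  shows "\<exists>I\<subseteq>A. card I = h \<and>
    (\<Sum>a\<in>A. \<Sum>b\<in>A. M a b * (side_sign I a * side_sign I b)) \<le> (\<Sum>a\<in>A. M a a + w a)"
  using assms
proof (induction h arbitrary: A)
  case 0
  then show ?case by auto
next
  case (Suc h)
  then have "card A = Suc (Suc (2 * h))" by simp
  then obtain a A' where a: "A = insert a A'" "a \<notin> A'" "card A' = Suc (2 * h)"
    by (metis card_Suc_eq)
  then obtain b B where b: "A' = insert b B" "b \<notin> B" "card B = 2 * h"
    by (metis card_Suc_eq)
  have A: "A = insert a (insert b B)" "a \<notin> B" "b \<notin> B" "a \<noteq> b" "finite B"
    using a b Suc.prems(1) by auto
  have "\<exists>I\<subseteq>B. card I = h \<and>
      (\<Sum>a\<in>B. \<Sum>b\<in>B. M a b * (side_sign I a * side_sign I b)) \<le> (\<Sum>a\<in>B. M a a + w a)"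
    using A b(3) by (intro Suc.IH Suc.prems(3)) auto
  then obtain I where I: "I \<subseteq> B" "card I = h"
      "(\<Sum>a\<in>B. \<Sum>b\<in>B. M a b * (side_sign I a * side_sign I b)) \<le> (\<Sum>a\<in>B. M a a + w a)"
    by blast
  have finI: "finite I" using I A finite_subset by blast
  \<comment> \<open>\<open>S x\<close> is the coefficient of the sign of \<open>x\<close> in the
    terms shared with \<open>B\<close>. Opposite signs for the two new elements contribute
    \<open>S x - S y\<close>, so the plus sign goes to the one with the smaller value.\<close>
  define S where "S x = (\<Sum>c\<in>B. (M x c + M c x) * side_sign I c)" for x
  have ext: "\<exists>I'\<subseteq>A. card I' = Suc h \<and>
      (\<Sum>a\<in>A. \<Sum>b\<in>A. M a b * (side_sign I' a * side_sign I' b)) \<le> (\<Sum>a\<in>A. M a a + w a)"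
    if xy: "A = insert x (insert y B)" "x \<notin> B" "y \<notin> B" "x \<noteq> y" and S: "S x \<le> S y" for x y
  proof -
    let ?I = "insert x I"
    have xI: "x \<notin> I" "y \<notin> I" using I xy by auto
    have sB: "side_sign ?I c = side_sign I c" if "c \<in> B" for c
      using that xy by (auto simp: side_sign_def)
    have sx: "side_sign ?I x = 1" "side_sign ?I y = -1" using xI xy by (auto simp: side_sign_def)
    have "(\<Sum>a\<in>A. \<Sum>b\<in>A. M a b * (side_sign ?I a * side_sign ?I b))
       = M x x + M y y - (M x y + M y x) + S x - S y
         + (\<Sum>a\<in>B. \<Sum>b\<in>B. M a b * (side_sign I a * side_sign I b))"
      unfolding xy(1) quadratic_form_insert2[OF A(5) xy(2-4)]
      by (simp add: S_def sx sB algebra_simps sum.distrib sum_negf sum_subtractf cong: sum.cong)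
    also have "\<dots> \<le> (M x x + w x) + (M y y + w y) + (\<Sum>a\<in>B. M a a + w a)"
    proof -
      have "- (w x + w y) \<le> M x y + M y x" using Suc.prems(3) xy by auto
      then show ?thesis using I(3) S by linarith
    qed
    also have "\<dots> = (\<Sum>a\<in>A. M a a + w a)" unfolding xy(1) using xy(2-4) A(5) by simp
    finally show ?thesis using I xI finI xy by (intro exI[of _ ?I]) auto
  qed
  show ?case
  proof (cases "S a \<le> S b")
    case True
    then show ?thesis using ext[of a b] A by blast
  next
    case False
    then show ?thesis using ext[of b a] A by (simp add: insert_commute)
  qed
qed

lemma card_inter_side_sign:
  assumes "finite A" "I \<subseteq> A"
  shows "real (card {b\<in>I. R b}) = (real (card {b\<in>A. R b}) + (\<Sum>b\<in>A. of_bool (R b) * side_sign I b)) / 2"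
    and "real (card {b\<in>A - I. R b}) = (real (card {b\<in>A. R b}) - (\<Sum>b\<in>A. of_bool (R b) * side_sign I b)) / 2"
proof -
  have fin: "finite I" using assms finite_subset by blast
  have split: "(\<Sum>b\<in>A. f b) = (\<Sum>b\<in>I. f b) + (\<Sum>b\<in>A - I. f b)" for f :: "'a \<Rightarrow> real"
    using assms fin by (metis add.commute sum.subset_diff)
  have card: "real (card {b\<in>B. R b}) = (\<Sum>b\<in>B. of_bool (R b))" if "finite B" for B
    using that by (simp add: sum.If_cases of_bool_def Int_def)
  have "(\<Sum>b\<in>A. of_bool (R b) * side_sign I b)
      = (\<Sum>b\<in>I. of_bool (R b)) - (\<Sum>b\<in>A - I. of_bool (R b))"
    unfolding split sum_negf[symmetric] diff_conv_add_uminus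
    by (intro arg_cong2[where f = "(+)"] sum.cong) (auto simp: side_sign_def)
  moreover have "real (card {b\<in>A. R b}) = (\<Sum>b\<in>I. of_bool (R b)) + (\<Sum>b\<in>A - I. of_bool (R b))"
    using card[OF assms(1)] split[of "\<lambda>b. of_bool (R b)"] by linarith
  ultimately show "real (card {b\<in>I. R b}) = (real (card {b\<in>A. R b}) + (\<Sum>b\<in>A. of_bool (R b) * side_sign I b)) / 2"
    "real (card {b\<in>A - I. R b}) = (real (card {b\<in>A. R b}) - (\<Sum>b\<in>A. of_bool (R b) * side_sign I b)) / 2"
    using card[OF fin] card[of "A - I"] assms by (simp_all del: sum_of_bool_eq)
qed

lemma sum_codegree_form:
  fixes s :: "'a \<Rightarrow> real" and c :: "'a \<Rightarrow> 'a \<Rightarrow> real"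
  shows "(\<Sum>a\<in>A. \<Sum>b\<in>A. (\<Sum>v\<in>A. c v a * c v b) * (s a * s b)) = (\<Sum>v\<in>A. (\<Sum>a\<in>A. c v a * s a)\<^sup>2)"
proof -
  have "(\<Sum>v\<in>A. (\<Sum>a\<in>A. c v a * s a)\<^sup>2) = (\<Sum>v\<in>A. \<Sum>a\<in>A. \<Sum>b\<in>A. c v a * c v b * (s a * s b))"
    by (simp add: power2_eq_square sum_product mult_ac)
  also have "\<dots> = (\<Sum>a\<in>A. \<Sum>v\<in>A. \<Sum>b\<in>A. c v a * c v b * (s a * s b))"
    by (rule sum.swap)
  also have "\<dots> = (\<Sum>a\<in>A. \<Sum>b\<in>A. \<Sum>v\<in>A. c v a * c v b * (s a * s b))"
    by (intro sum.cong refl sum.swap)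
  finally show ?thesis by (simp add: sum_distrib_right)
qed

text \<open>\<open>\<alpha>\<close> relates the ends about to be joined, so its degrees matter
  across the split; \<open>\<beta>\<close> relates the ends that survive, so its degrees matter
  within each side. One quadratic form in the signs has to serve both. The \<open>\<beta>\<close>
  bound reproduces the energy hypothesis for \<open>h\<close> and \<open>d / 2\<close> and can be
  iterated, whereas the \<open>\<alpha>\<close> bound is used in one round only and may be
  cruder.\<close>

lemma balanced_split:
  fixes \<alpha> \<beta> :: "'a \<Rightarrow> 'a \<Rightarrow> bool" and d :: real
  assumes fin: "finite A" and card: "card A = 2 * h" and d: "d \<ge> 4"
    and sym: "\<And>a b. \<alpha> a b = \<alpha> b a" "\<And>a b. \<beta> a b = \<beta> b a" and irr: "\<And>a. \<not> \<beta> a a"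
    and le: "(\<Sum>a\<in>A. (real (card {b\<in>A. \<beta> a b}) - d)\<^sup>2) \<le> (\<Sum>a\<in>A. (real (card {b\<in>A. \<alpha> a b}) - d)\<^sup>2)"
    and E: "(\<Sum>a\<in>A. (real (card {b\<in>A. \<alpha> a b}) - d)\<^sup>2) + (\<Sum>a\<in>A. (real (card {b\<in>A. \<beta> a b}) - d)\<^sup>2)
        \<le> 64 * real (card A) * d"
  shows "\<exists>I\<subseteq>A. card I = h \<and>
    (\<Sum>a\<in>I. (real (card {b\<in>I. \<beta> a b}) - d / 2)\<^sup>2) + (\<Sum>a\<in>A - I. (real (card {b\<in>A - I. \<beta> a b}) - d / 2)\<^sup>2)
      \<le> 64 * real h * (d / 2) \<and>
    (\<Sum>a\<in>I. (real (card {b\<in>A - I. \<alpha> a b}) - d / 2)\<^sup>2) + (\<Sum>b\<in>A - I. (real (card {a\<in>I. \<alpha> a b}) - d / 2)\<^sup>2)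
      \<le> 80 * real h * d"
proof -
  define x where "x a = real (card {b\<in>A. \<alpha> a b}) - d" for a
  define y where "y a = real (card {b\<in>A. \<beta> a b}) - d" for a
  define cx :: "'a \<Rightarrow> 'a \<Rightarrow> real" where "cx a b = of_bool (\<alpha> a b)" for a b
  define cy :: "'a \<Rightarrow> 'a \<Rightarrow> real" where "cy a b = of_bool (\<beta> a b)" for a b
  have deg: "(\<Sum>b\<in>A. cx a b) = x a + d" "(\<Sum>b\<in>A. cy a b) = y a + d" for a
    using fin by (simp_all add: x_def y_def cx_def cy_def sum.If_cases of_bool_def Int_def)
  \<comment> \<open>The codegree terms become the squared imbalances \<open>(gx v)^2\<close> and
    \<open>(gy v)^2\<close>, the last term becomes \<open>y a * s a * gy a\<close>. The weights
    \<open>1/4\<close> and \<open>1/2\<close> are those in the expansion of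
    \<open>((y a + s a * gy a) / 2)^2\<close>, the squared deviation of the
    \<open>\<beta>\<close>-degree within the side of \<open>a\<close>. The diagonal yields only
    degree sums, of order \<open>card A * d\<close>.\<close>
  define M where "M a b = (\<Sum>v\<in>A. cx v a * cx v b) + (\<Sum>v\<in>A. cy v a * cy v b) / 4 + y a * cy a b / 2" for a b
  have nonneg: "(\<Sum>v\<in>A. cx v a * cx v b) \<ge> 0" "(\<Sum>v\<in>A. cy v a * cy v b) \<ge> 0" for a b
    by (auto intro!: sum_nonneg simp: cx_def cy_def)
  have "- (\<bar>y a\<bar> / 2 + \<bar>y b\<bar> / 2) \<le> M a b + M b a" for a b
  proof -
    have "y a * cy a b / 2 + y b * cy b a / 2 \<ge> - (\<bar>y a\<bar> / 2 + \<bar>y b\<bar> / 2)"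
      using sym(2)[of a b] by (auto simp: cy_def)
    then show ?thesis using nonneg[of a b] nonneg[of b a] by (simp add: M_def)
  qed
  then obtain I where I: "I \<subseteq> A" "card I = h" and
    Q: "(\<Sum>a\<in>A. \<Sum>b\<in>A. M a b * (side_sign I a * side_sign I b)) \<le> (\<Sum>a\<in>A. M a a + \<bar>y a\<bar> / 2)"
    using balanced_signs[OF fin card, of "\<lambda>a. \<bar>y a\<bar> / 2" M] by blast
  define s where "s = side_sign I"
  define gx where "gx a = (\<Sum>b\<in>A. cx a b * s b)" for a
  define gy where "gy a = (\<Sum>b\<in>A. cy a b * s b)" for a
  have Qeq: "(\<Sum>a\<in>A. \<Sum>b\<in>A. M a b * (s a * s b))
      = (\<Sum>v\<in>A. (gx v)\<^sup>2) + (\<Sum>v\<in>A. (gy v)\<^sup>2) / 4 + (\<Sum>a\<in>A. y a * (s a * gy a)) / 2"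
  proof -
    have "(\<Sum>a\<in>A. \<Sum>b\<in>A. M a b * (s a * s b))
      = (\<Sum>a\<in>A. \<Sum>b\<in>A. (\<Sum>v\<in>A. cx v a * cx v b) * (s a * s b))
      + (\<Sum>a\<in>A. \<Sum>b\<in>A. (\<Sum>v\<in>A. cy v a * cy v b) * (s a * s b)) / 4
      + (\<Sum>a\<in>A. \<Sum>b\<in>A. y a * cy a b * (s a * s b)) / 2"
    proof -
      have "M a b * (s a * s b) = (\<Sum>v\<in>A. cx v a * cx v b) * (s a * s b)
        + (\<Sum>v\<in>A. cy v a * cy v b) * (s a * s b) / 4 + y a * cy a b * (s a * s b) / 2" for a b
        by (simp add: M_def field_simps)
      then show ?thesis by (simp only: sum.distrib sum_divide_distrib)
    qed
    also have "(\<Sum>a\<in>A. \<Sum>b\<in>A. y a * cy a b * (s a * s b)) = (\<Sum>a\<in>A. y a * (s a * gy a))"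
      by (simp add: gy_def sum_distrib_left mult_ac)
    finally show ?thesis by (simp add: sum_codegree_form gx_def gy_def)
  qed
  have tr: "(\<Sum>a\<in>A. M a a + \<bar>y a\<bar> / 2) = (\<Sum>a\<in>A. x a + d) + (\<Sum>a\<in>A. y a + d) / 4 + (\<Sum>a\<in>A. \<bar>y a\<bar>) / 2"
  proof -
    have "(\<Sum>a\<in>A. \<Sum>v\<in>A. cx v a * cx v a) = (\<Sum>v\<in>A. \<Sum>a\<in>A. cx v a)"
      by (subst sum.swap) (auto simp: cx_def intro!: sum.cong)
    moreover have "(\<Sum>a\<in>A. \<Sum>v\<in>A. cy v a * cy v a) = (\<Sum>v\<in>A. \<Sum>a\<in>A. cy v a)"
      by (subst sum.swap) (auto simp: cy_def intro!: sum.cong)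
    moreover have "cy a a = 0" for a using irr by (simp add: cy_def)
    ultimately show ?thesis
      by (simp add: M_def sum.distrib sum_divide_distrib[symmetric] deg)
  qed
  define Ex where "Ex = (\<Sum>a\<in>A. (x a)\<^sup>2)"
  define Ey where "Ey = (\<Sum>a\<in>A. (y a)\<^sup>2)"
  define N where "N = real (card A)"
  have N: "N = 2 * real h" using card by (simp add: N_def)
  have Exy: "Ey \<le> Ex" "Ex + Ey \<le> 64 * (N * d)"
    using le E by (simp_all add: Ex_def Ey_def x_def y_def N_def)
  have quad: "\<bar>z\<bar> \<le> z\<^sup>2 / 16 + 4" for z :: real
    using zero_le_power2[of "\<bar>z\<bar> / 4 - 2"] by (simp add: power2_eq_square algebra_simps)
  have absx: "(\<Sum>a\<in>A. \<bar>x a\<bar>) \<le> Ex / 16 + 4 * N"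
  proof -
    have "(\<Sum>a\<in>A. \<bar>x a\<bar>) \<le> (\<Sum>a\<in>A. (x a)\<^sup>2 / 16 + 4)" by (intro sum_mono quad)
    then show ?thesis by (simp add: sum.distrib sum_divide_distrib[symmetric] Ex_def N_def mult.commute)
  qed
  have absy: "(\<Sum>a\<in>A. \<bar>y a\<bar>) \<le> Ey / 16 + 4 * N"
  proof -
    have "(\<Sum>a\<in>A. \<bar>y a\<bar>) \<le> (\<Sum>a\<in>A. (y a)\<^sup>2 / 16 + 4)" by (intro sum_mono quad)
    then show ?thesis by (simp add: sum.distrib sum_divide_distrib[symmetric] Ey_def N_def mult.commute)
  qed
  have sumx: "(\<Sum>a\<in>A. x a) \<le> (\<Sum>a\<in>A. \<bar>x a\<bar>)" "(\<Sum>a\<in>A. y a) \<le> (\<Sum>a\<in>A. \<bar>y a\<bar>)"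
    by (intro sum_mono; simp)+
  have Ey0: "0 \<le> Ey" unfolding Ey_def by (intro sum_nonneg) auto
  have Nd: "4 * N \<le> N * d" using mult_right_mono[OF d, of N] by (simp add: N_def mult.commute)
  have "(\<Sum>v\<in>A. (gx v)\<^sup>2) + (\<Sum>v\<in>A. (gy v)\<^sup>2) / 4 + (\<Sum>a\<in>A. y a * (s a * gy a)) / 2
      \<le> N * d + (\<Sum>a\<in>A. x a) + (N * d + (\<Sum>a\<in>A. y a)) / 4 + (\<Sum>a\<in>A. \<bar>y a\<bar>) / 2"
    using Q unfolding s_def[symmetric] Qeq tr by (simp add: sum.distrib N_def algebra_simps)
  then have main: "(\<Sum>v\<in>A. (gx v)\<^sup>2) + ((\<Sum>v\<in>A. (gy v)\<^sup>2) / 4 + (\<Sum>a\<in>A. y a * (s a * gy a)) / 2 + Ey / 4)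
      \<le> 16 * (N * d)"
  proof -
    \<comment> \<open>With \<open>D = N * d\<close> the trace contributes \<open>5/4 D\<close>, the
      linear terms at most \<open>(Ex + Ey) / 16 + 7 N\<close>, hence \<open>23/4 D\<close>, and the
      inherited part \<open>Ey / 4\<close> at most \<open>8 D\<close>, because \<open>Ey\<close> is
      the smaller energy. The total of \<open>15 D\<close> fits into
      \<open>16 D = 64 h (d / 2)\<close>.\<close>
    have arith: "p + (q / 4 + r / 2 + Ey / 4) \<le> 16 * D"
      if "p + q / 4 + r / 2 \<le> D + sx + (D + sy) / 4 + ay / 2" "ax \<le> Ex / 16 + 4 * N"
        "ay \<le> Ey / 16 + 4 * N" "sx \<le> ax" "sy \<le> ay" "Ex + Ey \<le> 64 * D" "4 * N \<le> D"
      for p q r D sx sy ax ay :: real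
    proof -
      have "sx + sy / 4 + ay / 2 \<le> Ex / 16 + Ey / 16 + 7 * N" using that Ey0 by linarith
      moreover have "Ey \<le> 32 * D" using that Exy by linarith
      moreover have "p + q / 4 + r / 2 \<le> 5 / 4 * D + (sx + sy / 4 + ay / 2)"
        using that(1) by (simp add: add_divide_distrib)
      ultimately show ?thesis using that(6,7) Ey0 by linarith
    qed
    show ?thesis using \<open>_ \<le> N * d + _ + _ + _\<close> absx absy sumx Exy(2) Nd by (rule arith)
  qed
  have fI: "finite I" using I fin finite_subset by blast
  have split: "(\<Sum>a\<in>A. f a) = (\<Sum>a\<in>I. f a) + (\<Sum>a\<in>A - I. f a)" for f :: "'a \<Rightarrow> real"
    using I fin fI by (metis add.commute sum.subset_diff)
  have degy: "real (card {b\<in>I. \<beta> a b}) = (y a + d + gy a) / 2"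
      "real (card {b\<in>A - I. \<beta> a b}) = (y a + d - gy a) / 2" for a
    unfolding card_inter_side_sign[OF fin I(1)] y_def gy_def cy_def s_def by simp_all
  have degx: "real (card {b\<in>I. \<alpha> a b}) = (x a + d + gx a) / 2"
      "real (card {b\<in>A - I. \<alpha> a b}) = (x a + d - gx a) / 2" for a
    unfolding card_inter_side_sign[OF fin I(1)] x_def gx_def cx_def s_def by simp_all
  have yI: "(\<Sum>a\<in>I. (real (card {b\<in>I. \<beta> a b}) - d / 2)\<^sup>2) + (\<Sum>a\<in>A - I. (real (card {b\<in>A - I. \<beta> a b}) - d / 2)\<^sup>2)
      = (\<Sum>a\<in>A. ((y a + s a * gy a) / 2)\<^sup>2)"
    unfolding split degy
    by (intro arg_cong2[where f = "(+)"] sum.cong refl arg_cong[where f = "\<lambda>z. z\<^sup>2"])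
      (simp_all add: s_def side_sign_def diff_divide_distrib add_divide_distrib)
  also have "\<dots> = (\<Sum>v\<in>A. (gy v)\<^sup>2) / 4 + (\<Sum>a\<in>A. y a * (s a * gy a)) / 2 + Ey / 4"
  proof -
    have "((y a + s a * gy a) / 2)\<^sup>2 = (gy a)\<^sup>2 / 4 + y a * (s a * gy a) / 2 + (y a)\<^sup>2 / 4" for a
      by (simp add: s_def side_sign_def power2_eq_square field_simps)
    then show ?thesis by (simp add: sum.distrib sum_divide_distrib Ey_def)
  qed
  finally have yE: "(\<Sum>a\<in>I. (real (card {b\<in>I. \<beta> a b}) - d / 2)\<^sup>2) + (\<Sum>a\<in>A - I. (real (card {b\<in>A - I. \<beta> a b}) - d / 2)\<^sup>2)
      = (\<Sum>v\<in>A. (gy v)\<^sup>2) / 4 + (\<Sum>a\<in>A. y a * (s a * gy a)) / 2 + Ey / 4" .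
  have "(\<Sum>a\<in>I. (real (card {b\<in>I. \<beta> a b}) - d / 2)\<^sup>2) + (\<Sum>a\<in>A - I. (real (card {b\<in>A - I. \<beta> a b}) - d / 2)\<^sup>2) \<ge> 0"
    by (intro add_nonneg_nonneg sum_nonneg) auto
  then have gx: "(\<Sum>v\<in>A. (gx v)\<^sup>2) \<le> 16 * (N * d)" using main yE by linarith
  have gx0: "(\<Sum>v\<in>A. (gx v)\<^sup>2) \<ge> 0" by (intro sum_nonneg) auto
  have symset: "{a\<in>I. \<alpha> a b} = {a\<in>I. \<alpha> b a}" for b using sym(1) by blast
  have "(\<Sum>a\<in>I. (real (card {b\<in>A - I. \<alpha> a b}) - d / 2)\<^sup>2) + (\<Sum>b\<in>A - I. (real (card {a\<in>I. \<alpha> a b}) - d / 2)\<^sup>2)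
      = (\<Sum>a\<in>A. ((x a - s a * gx a) / 2)\<^sup>2)"
    unfolding split symset degx
    by (intro arg_cong2[where f = "(+)"] sum.cong refl arg_cong[where f = "\<lambda>z. z\<^sup>2"])
      (simp_all add: s_def side_sign_def diff_divide_distrib add_divide_distrib)
  \<comment> \<open>\<open>M\<close> has no term governing the mixed products
    \<open>x a * s a * gx a\<close>, so the squared deviation of the \<open>\<alpha>\<close>-degree
    within the own side is simply added.\<close>
  also have "\<dots> \<le> (\<Sum>a\<in>A. (x a)\<^sup>2 / 2 + (gx a)\<^sup>2 / 2)"
  proof (rule sum_mono)
    fix a
    have "((x a - s a * gx a) / 2)\<^sup>2 + ((x a + s a * gx a) / 2)\<^sup>2 = (x a)\<^sup>2 / 2 + (gx a)\<^sup>2 / 2"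
      by (simp add: s_def side_sign_def power2_eq_square field_simps)
    then show "((x a - s a * gx a) / 2)\<^sup>2 \<le> (x a)\<^sup>2 / 2 + (gx a)\<^sup>2 / 2"
      using zero_le_power2[of "(x a + s a * gx a) / 2"] by linarith
  qed
  also have "\<dots> = Ex / 2 + (\<Sum>v\<in>A. (gx v)\<^sup>2) / 2"
    by (simp add: sum.distrib sum_divide_distrib Ex_def)
  also have "\<dots> \<le> 40 * (N * d)" using gx Exy Ey0 by linarith
  finally show ?thesis
    using I main yE gx0 N by (intro exI[of _ I]) (auto simp: algebra_simps)
qed

section \<open>Orderings of a regular graph with few defects\<close>

fun defects :: "'a set set \<Rightarrow> 'a list \<Rightarrow> nat" where
  "defects E [] = 0"
| "defects E [x] = 0"
| "defects E (x # y # zs) = of_bool ({x, y} \<notin> E) + defects E (y # zs)"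

lemma defects_append:
  "xs \<noteq> [] \<Longrightarrow> ys \<noteq> [] \<Longrightarrow>
    defects E (xs @ ys) = defects E xs + of_bool ({last xs, hd ys} \<notin> E) + defects E ys"
proof (induction E xs rule: defects.induct)
  case (2 E x)
  then show ?case by (cases ys) auto
qed auto

lemma defects_rev: "defects E (rev xs) = defects E xs"
proof (induction E xs rule: defects.induct)
  case (3 E x y zs)
  have "defects E (rev (x # y # zs)) = defects E (rev (y # zs) @ [x])" by simp
  also have "\<dots> = defects E (rev (y # zs)) + of_bool ({y, x} \<notin> E)"
    by (subst defects_append) auto
  finally show ?case using 3 by (simp add: insert_commute)
qed auto

lemma defects_le_length: "defects E xs \<le> length xs - 1"
  by (induction E xs rule: defects.induct) (auto simp: of_bool_def)

lemma defects_append_le: "defects E (xs @ ys) \<le> defects E xs + length ys"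
proof (cases "xs = [] \<or> ys = []")
  case True
  then show ?thesis using defects_le_length[of E ys] by auto
next
  case False
  then have "length ys \<ge> 1" by (cases ys) auto
  then show ?thesis
    using False defects_le_length[of E ys] by (auto simp: defects_append of_bool_def)
qed

lemma defects_mono: "E \<subseteq> E' \<Longrightarrow> defects E' xs \<le> defects E xs"
  by (induction E xs rule: defects.induct) auto

lemma defects_zero_nth:
  "defects E xs = 0 \<Longrightarrow> Suc i < length xs \<Longrightarrow> {xs ! i, xs ! Suc i} \<in> E"
proof (induction E xs arbitrary: i rule: defects.induct)
  case (3 E x y zs)
  then show ?case by (cases i) auto
qed auto

text \<open>A member of \<open>P\<close> need not be a path of the graph: a failed merge still
  concatenates two lists and is charged as a defect, so the number of lists halves exactly.\<close>

definition path_system :: "'a list set \<Rightarrow> bool" where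
  "path_system P \<longleftrightarrow> finite P \<and> (\<forall>p\<in>P. p \<noteq> [] \<and> distinct p) \<and>
     (\<forall>p\<in>P. \<forall>q\<in>P. p \<noteq> q \<longrightarrow> set p \<inter> set q = {})"

text \<open>The selector \<open>f\<close> and the free index type let heads, last entries and
  reindexed ends of merged lists be compared directly.\<close>

definition end_energy :: "'a set set \<Rightarrow> ('b \<Rightarrow> 'a) \<Rightarrow> 'b set \<Rightarrow> real \<Rightarrow> real" where
  "end_energy E f P d = (\<Sum>p\<in>P. (real (card {q\<in>P. {f p, f q} \<in> E}) - d)\<^sup>2)"

lemma end_energy_image:
  assumes "inj_on h I"
  shows "end_energy E g (h ` I) d = end_energy E (g \<circ> h) I d"
proof -
  have "card {q\<in>h ` I. {x, g q} \<in> E} = card {q\<in>I. {x, g (h q)} \<in> E}" for x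
  proof -
    have "{q\<in>h ` I. {x, g q} \<in> E} = h ` {q\<in>I. {x, g (h q)} \<in> E}" by auto
    then show ?thesis using assms by (metis (no_types, lifting) card_image inj_on_subset mem_Collect_eq subsetI)
  qed
  then show ?thesis unfolding end_energy_def using assms by (simp add: sum.reindex)
qed

lemma end_energy_cong:
  assumes "\<And>p. p \<in> P \<Longrightarrow> f p = g p"
  shows "end_energy E f P d = end_energy E g P d"
proof -
  have "{q\<in>P. {f p, f q} \<in> E} = {q\<in>P. {g p, g q} \<in> E}" if "p \<in> P" for p
    using assms that by auto
  then show ?thesis unfolding end_energy_def by (intro sum.cong) auto
qed

text \<open>The \<open>X\<close> ends are consumed and the \<open>Y\<close> ends survive;
  \<open>J\<close> covers both orientations. The list merged from \<open>p \<in> I\<close> and its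
  partner in \<open>P - I\<close> starts at a \<open>Y\<close> end from \<open>I\<close> and stops
  at a \<open>Y\<close> end from \<open>P - I\<close>, so the two within-side sums of
  \<open>balanced_split\<close> are precisely the head and last energies of the new system. The new
  defects are the non-adjacent matched pairs.\<close>

lemma join_step:
  fixes P :: "'a list set" and X Y :: "'a list \<Rightarrow> 'a" and J :: "'a list \<Rightarrow> 'a list \<Rightarrow> 'a list"
  assumes P: "path_system P" and card: "card P = 2 * h" and d: "d \<ge> 4"
    and irr: "\<And>x. {x} \<notin> E"
    and Y: "\<And>p. p \<noteq> [] \<Longrightarrow> Y p \<in> set p"
    and J: "\<And>p q. p \<noteq> [] \<Longrightarrow> q \<noteq> [] \<Longrightarrow> hd (J p q) = Y p \<and> last (J p q) = Y q \<and> J p q \<noteq> [] \<and>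
         set (J p q) = set p \<union> set q \<and> length (J p q) = length p + length q \<and>
         defects E (J p q) = defects E p + defects E q + of_bool ({X p, X q} \<notin> E)"
    and le: "end_energy E Y P d \<le> end_energy E X P d"
    and en: "end_energy E X P d + end_energy E Y P d \<le> 64 * real (card P) * d"
  shows "\<exists>P'. path_system P' \<and> card P' = h \<and> \<Union>(set ` P') = \<Union>(set ` P) \<and>
     end_energy E last P' (d / 2) + end_energy E hd P' (d / 2) \<le> 64 * real h * (d / 2) \<and>
     real (\<Sum>p\<in>P'. defects E p) \<le> real (\<Sum>p\<in>P. defects E p) + 13 * real (card P) / sqrt d"
proof -
  have fin: "finite P" and ne: "\<And>p. p \<in> P \<Longrightarrow> p \<noteq> []" and dist: "\<And>p. p \<in> P \<Longrightarrow> distinct p"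
    and disj: "\<And>p q. p \<in> P \<Longrightarrow> q \<in> P \<Longrightarrow> p \<noteq> q \<Longrightarrow> set p \<inter> set q = {}"
    using P by (auto simp: path_system_def)
  have "\<exists>I\<subseteq>P. card I = h \<and>
    (\<Sum>a\<in>I. (real (card {b\<in>I. {Y a, Y b} \<in> E}) - d / 2)\<^sup>2) +
      (\<Sum>a\<in>P - I. (real (card {b\<in>P - I. {Y a, Y b} \<in> E}) - d / 2)\<^sup>2) \<le> 64 * real h * (d / 2) \<and>
    (\<Sum>a\<in>I. (real (card {b\<in>P - I. {X a, X b} \<in> E}) - d / 2)\<^sup>2) +
      (\<Sum>b\<in>P - I. (real (card {a\<in>I. {X a, X b} \<in> E}) - d / 2)\<^sup>2) \<le> 80 * real h * d"
    using fin card d le en irr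
    by (intro balanced_split[where \<alpha> = "\<lambda>a b. {X a, X b} \<in> E" and \<beta> = "\<lambda>a b. {Y a, Y b} \<in> E"])
      (auto simp: end_energy_def insert_commute)
  then obtain I where I: "I \<subseteq> P" "card I = h"
    and EY: "end_energy E Y I (d / 2) + end_energy E Y (P - I) (d / 2) \<le> 64 * real h * (d / 2)"
    and EX: "(\<Sum>a\<in>I. (real (card {b\<in>P - I. {X a, X b} \<in> E}) - d / 2)\<^sup>2) +
      (\<Sum>b\<in>P - I. (real (card {a\<in>I. {X a, X b} \<in> E}) - d / 2)\<^sup>2) \<le> 80 * real h * d"
    unfolding end_energy_def by blast
  have finI: "finite I" using I fin finite_subset by blast
  have cardJ: "card (P - I) = h" using I card finI by (simp add: card_Diff_subset)
  obtain f where f: "bij_betw f I (P - I)"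
    and bad: "real (card {a\<in>I. {X a, X (f a)} \<notin> E}) \<le> sqrt (2 * real (card I) * (80 * real h * d)) / (d / 2)"
    using almost_regular_bijection[where R = "\<lambda>a b. {X a, X b} \<in> E" and I = I and J = "P - I" and d = "d / 2",
        OF finI _ _ _ _ EX] fin I cardJ d by auto
  \<comment> \<open>Here \<open>2 * 80 = 160 \<le> 13^2\<close>, and dividing
    \<open>13 h sqrt d\<close> by \<open>d / 2\<close> gives \<open>26 h / sqrt d\<close> with
    \<open>2 h = card P\<close>.\<close>
  have "sqrt (2 * real (card I) * (80 * real h * d)) / (d / 2) \<le> 13 * real (card P) / sqrt d"
  proof -
    have "2 * real (card I) * (80 * real h * d) \<le> 169 * (real h)\<^sup>2 * d"
      using I d by (simp add: power2_eq_square)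
    then have "sqrt (2 * real (card I) * (80 * real h * d)) \<le> sqrt (169 * (real h)\<^sup>2 * d)"
      by (rule real_sqrt_le_mono)
    also have "sqrt (169 * (real h)\<^sup>2 * d) = 13 * real h * sqrt d"
      by (simp add: real_sqrt_mult)
    finally have "sqrt (2 * real (card I) * (80 * real h * d)) / (d / 2) \<le> (13 * real h * sqrt d) / (d / 2)"
      using d by (intro divide_right_mono) auto
    also have "\<dots> = 13 * real (card P) / sqrt d"
      using d card by (simp add: field_simps)
    finally show ?thesis .
  qed
  with bad have bad: "real (card {a\<in>I. {X a, X (f a)} \<notin> E}) \<le> 13 * real (card P) / sqrt d"
    by linarith
  have fI: "f ` I = P - I" "inj_on f I" using f by (auto simp: bij_betw_def)
  have fP: "f p \<in> P" "f p \<notin> I" "p \<in> P" if "p \<in> I" for p using that fI I by auto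
  define K where "K p = J p (f p)" for p
  have K: "hd (K p) = Y p" "last (K p) = Y (f p)" "K p \<noteq> []" "set (K p) = set p \<union> set (f p)"
      "length (K p) = length p + length (f p)"
      "defects E (K p) = defects E p + defects E (f p) + of_bool ({X p, X (f p)} \<notin> E)" if "p \<in> I" for p
    using J[of p "f p"] ne fP[OF that] by (auto simp: K_def)
  have dK: "distinct (K p)" if "p \<in> I" for p
  proof -
    have "set p \<inter> set (f p) = {}" using fP[OF that] that by (intro disj) auto
    then have "card (set (K p)) = length (K p)"
      using K[OF that] dist[OF fP(1)[OF that]] dist[OF fP(3)[OF that]]
      by (simp add: card_Un_disjoint distinct_card)
    then show ?thesis by (rule card_distinct)
  qed
  have disjK: "set (K p) \<inter> set (K q) = {}" if "p \<in> I" "q \<in> I" "p \<noteq> q" for p q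
  proof -
    have "f p \<noteq> f q" using that fI by (auto simp: inj_on_def)
    then have "set p \<inter> set q = {}" "set p \<inter> set (f q) = {}" "set (f p) \<inter> set q = {}"
        "set (f p) \<inter> set (f q) = {}"
      using fP[OF that(1)] fP[OF that(2)] that by (intro disj; auto)+
    then show ?thesis using K(4) that by auto
  qed
  have injK: "inj_on K I"
    using disjK K(3) unfolding inj_on_def by (metis Int_absorb set_empty)
  have ps: "path_system (K ` I)"
    unfolding path_system_def using finI K(3) dK disjK by (auto 0 0) (metis disjoint_iff)
  have un: "\<Union>(set ` (K ` I)) = \<Union>(set ` P)"
  proof -
    have "\<Union>(set ` (K ` I)) = (\<Union>p\<in>I. set p) \<union> (\<Union>p\<in>I. set (f p))" using K(4) by auto
    also have "(\<Union>p\<in>I. set (f p)) = (\<Union>q\<in>P - I. set q)" unfolding fI(1)[symmetric] by auto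
    finally show ?thesis using I by auto
  qed
  have "end_energy E hd (K ` I) (d / 2) = end_energy E Y I (d / 2)"
    unfolding end_energy_image[OF injK] using K(1) by (intro end_energy_cong) auto
  moreover have "end_energy E last (K ` I) (d / 2) = end_energy E (Y \<circ> f) I (d / 2)"
    unfolding end_energy_image[OF injK] using K(2) by (intro end_energy_cong) auto
  moreover have "\<dots> = end_energy E Y (P - I) (d / 2)"
    unfolding end_energy_image[OF fI(2), symmetric] fI(1) ..
  moreover have "(\<Sum>q\<in>K ` I. defects E q) = (\<Sum>p\<in>P. defects E p) + card {a\<in>I. {X a, X (f a)} \<notin> E}"
  proof -
    have "(\<Sum>q\<in>K ` I. defects E q)
        = (\<Sum>p\<in>I. defects E p) + (\<Sum>p\<in>I. defects E (f p)) + (\<Sum>p\<in>I. of_bool ({X p, X (f p)} \<notin> E))"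
      using injK K(6) by (simp add: sum.reindex sum.distrib del: sum_of_bool_eq)
    also have "(\<Sum>p\<in>I. defects E (f p)) = (\<Sum>p\<in>P - I. defects E p)"
      using f by (rule sum.reindex_bij_betw)
    also have "(\<Sum>p\<in>I. defects E p) + (\<Sum>p\<in>P - I. defects E p) = (\<Sum>p\<in>P. defects E p)"
      using I fin by (metis add.commute sum.subset_diff)
    finally show ?thesis using finI by (simp add: Int_def)
  qed
  ultimately show ?thesis
    using ps un EY bad injK I by (intro exI[of _ "K ` I"]) (auto simp: card_image)
qed

lemma concat_path_system:
  assumes "path_system P"
  shows "\<exists>zs. distinct zs \<and> set zs = \<Union>(set ` P) \<and> defects E zs \<le> (\<Sum>p\<in>P. defects E p) + card P"
proof -
  have "finite P" using assms by (simp add: path_system_def)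
  then show ?thesis using assms
  proof (induction P rule: finite_induct)
    case empty
    then show ?case by (intro exI[of _ "[]"]) auto
  next
    case (insert p P)
    then have "path_system P" by (auto simp: path_system_def)
    with insert.IH obtain zs where zs: "distinct zs" "set zs = \<Union>(set ` P)"
        "defects E zs \<le> (\<Sum>p\<in>P. defects E p) + card P" by blast
    have "distinct (p @ zs)"
      using insert zs by (fastforce simp: path_system_def)
    moreover have "defects E (p @ zs) \<le> defects E p + 1 + defects E zs"
      by (cases "p = [] \<or> zs = []") (auto simp: defects_append of_bool_def)
    ultimately show ?case using insert zs by (intro exI[of _ "p @ zs"]) auto
  qed
qed

text \<open>A round costs \<open>13 card P / sqrt d\<close>; halving both \<open>card P\<close> and
  \<open>d\<close> shrinks this by the factor \<open>sqrt 2\<close>, and \<open>50\<close> is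
  admissible since \<open>13 + 25 * sqrt 2 \<le> 50\<close>. The lower bound on \<open>d\<close>
  keeps it at least \<open>4\<close> as long as a round remains. The last \<open>q\<close> lists are
  concatenated at no more than one defect each.\<close>

lemma join_paths:
  fixes P :: "'a list set"
  assumes "path_system P" "card P = 2 ^ l * q" "d \<ge> 2 ^ (l + 1)"
    and irr: "\<And>x. {x} \<notin> E"
    and "end_energy E last P d + end_energy E hd P d \<le> 64 * real (card P) * d"
  shows "\<exists>zs. distinct zs \<and> set zs = \<Union>(set ` P) \<and>
     real (defects E zs) \<le> real (\<Sum>p\<in>P. defects E p) + 50 * real (card P) / sqrt d + real q"
  using assms(1-3,5)
proof (induction l arbitrary: P d)
  case 0
  then obtain zs where zs: "distinct zs" "set zs = \<Union>(set ` P)"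
      "defects E zs \<le> (\<Sum>p\<in>P. defects E p) + card P" using concat_path_system by blast
  have "real (defects E zs) \<le> real (\<Sum>p\<in>P. defects E p) + real (card P)"
    using zs(3) by linarith
  moreover have "50 * real (card P) / sqrt d \<ge> 0" using 0 by (intro divide_nonneg_nonneg) auto
  ultimately have "real (defects E zs) \<le> real (\<Sum>p\<in>P. defects E p) + 50 * real (card P) / sqrt d + real (card P)"
    by linarith
  then show ?case using zs(1,2) 0(2) by (intro exI[of _ zs]) simp
next
  case (Suc l)
  have "(2::real) ^ (Suc l + 1) \<ge> 4" using one_le_power[of "2::real" l] by simp
  then have d: "d \<ge> 4" using Suc.prems(3) by linarith
  have card: "card P = 2 * (2 ^ l * q)" using Suc.prems by simp
  have "\<exists>P'. path_system P' \<and> card P' = 2 ^ l * q \<and> \<Union>(set ` P') = \<Union>(set ` P) \<and>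
     end_energy E last P' (d / 2) + end_energy E hd P' (d / 2) \<le> 64 * real (2 ^ l * q) * (d / 2) \<and>
     real (\<Sum>p\<in>P'. defects E p) \<le> real (\<Sum>p\<in>P. defects E p) + 13 * real (card P) / sqrt d"
  proof (cases "end_energy E hd P d \<le> end_energy E last P d")
    case True
    show ?thesis
      by (rule join_step[where J = "\<lambda>p q. p @ rev q", OF Suc.prems(1) card d irr _ _ True Suc.prems(4)])
        (auto simp: defects_append defects_rev hd_rev last_rev)
  next
    case False
    show ?thesis
      by (rule join_step[where J = "\<lambda>p q. rev p @ q" and Y = last and X = hd, OF Suc.prems(1) card d irr])
        (use False Suc.prems(4) in \<open>auto simp: defects_append defects_rev hd_rev last_rev\<close>)
  qed
  then obtain P' where P': "path_system P'" "card P' = 2 ^ l * q" "\<Union>(set ` P') = \<Union>(set ` P)"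
     "end_energy E last P' (d / 2) + end_energy E hd P' (d / 2) \<le> 64 * real (card P') * (d / 2)"
     "real (\<Sum>p\<in>P'. defects E p) \<le> real (\<Sum>p\<in>P. defects E p) + 13 * real (card P) / sqrt d"
    by metis
  have "2 ^ (l + 1) \<le> d / 2" using Suc.prems(3) by simp
  from Suc.IH[OF P'(1,2) this P'(4)] obtain zs where zs: "distinct zs" "set zs = \<Union>(set ` P)"
     "real (defects E zs) \<le> real (\<Sum>p\<in>P'. defects E p) + 50 * real (card P') / sqrt (d / 2) + real q"
    using P'(3) by auto
  have "50 * real (card P') / sqrt (d / 2) \<le> 37 * real (card P) / sqrt d"
  proof -
    have "50 * real (card P') / sqrt (d / 2) = 25 * sqrt 2 * (real (card P) / sqrt d)"
      using card P'(2) by (simp add: real_sqrt_divide)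
    also have "\<dots> \<le> 37 * (real (card P) / sqrt d)"
      using d sqrt2_less_2 real_sqrt_le_mono[of 2 "(37/25)\<^sup>2"]
      by (intro mult_right_mono) (auto simp: power2_eq_square real_sqrt_divide)
    finally show ?thesis by simp
  qed
  moreover have "13 * real (card P) / sqrt d + 37 * real (card P) / sqrt d = 50 * real (card P) / sqrt d"
    by (simp add: field_simps)
  ultimately have "real (defects E zs) \<le> real (\<Sum>p\<in>P. defects E p) + 50 * real (card P) / sqrt d + real q"
    using zs(3) P'(5) by linarith
  then show ?case using zs by blast
qed

section \<open>Application to regular graphs\<close>

lemma all_pairs_not_singleton: "E \<subseteq> all_pairs n \<Longrightarrow> {x} \<notin> E"
  by (auto simp: all_pairs_def)

lemma regular_graph_degree:
  assumes "regular_graph n r E" "v < n"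
  shows "card {u. {v, u} \<in> E} = r" "{u. {v, u} \<in> E} \<subseteq> {..<n}"
proof -
  have E: "e \<subseteq> {..<n}" "card e = 2" if "e \<in> E" for e
    using assms that by (auto simp: regular_graph_def all_pairs_def)
  have "{e\<in>E. v \<in> e} = (\<lambda>u. {v, u}) ` {u. {v, u} \<in> E}"
  proof (intro equalityI subsetI)
    fix e assume e: "e \<in> {e\<in>E. v \<in> e}"
    then obtain a b where "e = {a, b}" using E(2) by (metis (lifting) card_2_iff mem_Collect_eq)
    with e show "e \<in> (\<lambda>u. {v, u}) ` {u. {v, u} \<in> E}" by (auto simp: insert_commute)
  qed auto
  moreover have "inj_on (\<lambda>u. {v, u}) {u. {v, u} \<in> E}"
    by (auto simp: inj_on_def doubleton_eq_iff)
  ultimately have "card {u. {v, u} \<in> E} = card {e\<in>E. v \<in> e}" by (simp add: card_image)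
  then show "card {u. {v, u} \<in> E} = r" using assms by (simp add: regular_graph_def)
  show "{u. {v, u} \<in> E} \<subseteq> {..<n}" using E(1) by auto
qed

lemma regular_graph_degree_le:
  assumes "regular_graph n r E" "n > 0"
  shows "r \<le> n"
  using regular_graph_degree[OF assms] card_mono[of "{..<n}"] by fastforce

text \<open>The merging may stop at about \<open>n / sqrt r\<close> lists, because concatenating
  these stays within the bound. With \<open>2^l\<close> between \<open>sqrt r / 2\<close> and
  \<open>sqrt r\<close>, cutting \<open>n\<close> down to a multiple \<open>m\<close> of
  \<open>2^l\<close> drops fewer than \<open>sqrt r\<close> vertices, so all degrees inside
  \<open>{..<m}\<close> are within \<open>sqrt r\<close> of \<open>r\<close> and the initial energy
  per end is at most \<open>m * r\<close>. The constant \<open>53\<close> is \<open>50\<close> for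
  merging, \<open>2\<close> for the final lists and \<open>1\<close> for the dropped vertices, as
  \<open>sqrt r \<le> n / sqrt r\<close>. For \<open>r < 16\<close> the bound exceeds
  \<open>n\<close>.\<close>

lemma regular_graph_ordering:
  assumes G: "regular_graph n r E" and r: "r > 0" and n: "n > 0"
  shows "\<exists>zs. distinct zs \<and> set zs = {..<n} \<and> real (defects E zs) \<le> 53 * (real n / sqrt (real r))"
proof (cases "r < 16")
  case True
  then have "sqrt (real r) < sqrt (4\<^sup>2)" by (intro real_sqrt_less_mono) simp
  then have "sqrt (real r) \<le> 53" by simp
  then have "real n * sqrt (real r) \<le> real n * 53" by (intro mult_left_mono) auto
  then have "real n \<le> 53 * (real n / sqrt (real r))" using r by (simp add: field_simps)
  moreover have "real (defects E [0..<n]) \<le> real n" using defects_le_length[of E "[0..<n]"] by simp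
  ultimately show ?thesis by (intro exI[of _ "[0..<n]"]) auto
next
  case False
  define k where "k = nat \<lfloor>sqrt (real r)\<rfloor>"
  have "sqrt (real r) \<ge> 1" using r by simp
  then have k: "k \<ge> 1" "real k \<le> sqrt (real r)" "sqrt (real r) < real k + 1"
    unfolding k_def by linarith+
  obtain l where l: "2 ^ l \<le> k" "k < 2 ^ (l + 1)" using ex_power_ivl1[of 2 k] k by auto
  have l1: "2 ^ l \<le> sqrt (real r)" using l(1) k(2) by (metis (mono_tags, lifting) of_nat_le_iff of_nat_numeral of_nat_power order_trans)
  have "real (k + 1) \<le> real (2 ^ (l + 1))" using l(2) by (intro of_nat_mono) simp
  then have l2: "sqrt (real r) \<le> 2 * 2 ^ l" using k(3) by simp
  define q where "q = n div 2 ^ l"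
  define m where "m = 2 ^ l * q"
  have m: "m \<le> n" "n - m < 2 ^ l"
    by (simp_all add: m_def q_def) (metis minus_mult_div_eq_mod mod_less_divisor pos2 zero_less_power)
  define P where "P = (\<lambda>v. [v]) ` {..<m}"
  have ps: "path_system P" by (auto simp: path_system_def P_def)
  have cardP: "card P = m" unfolding P_def by (subst card_image) (auto simp: inj_on_def)
  have E: "E \<subseteq> all_pairs n" using G by (simp add: regular_graph_def)
  have rr: "sqrt (real r) * sqrt (real r) = real r" by simp
  have en: "end_energy E f P (real r) \<le> real m * real r" if f: "\<And>v. f [v] = v" for f
  proof -
    have "end_energy E f P (real r) = end_energy E (f \<circ> (\<lambda>v. [v])) {..<m} (real r)"
      unfolding P_def by (intro end_energy_image) (auto simp: inj_on_def)
    also have "\<dots> = (\<Sum>v<m. (real (card {u\<in>{..<m}. {v, u} \<in> E}) - real r)\<^sup>2)"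
      by (simp add: end_energy_def f)
    also have "\<dots> \<le> (\<Sum>v<m. real r)"
    proof (rule sum_mono)
      fix v assume "v \<in> {..<m}"
      then have v: "v < n" using m by simp
      note deg = regular_graph_degree[OF G v]
      have fin: "finite {u. {v, u} \<in> E}" using deg(2) finite_subset by blast
      have 1: "card {u\<in>{..<m}. {v, u} \<in> E} \<le> r"
        unfolding deg(1)[symmetric] using fin by (intro card_mono) auto
      have "{u. {v, u} \<in> E} \<subseteq> {u\<in>{..<m}. {v, u} \<in> E} \<union> {m..<n}" using deg(2) by auto
      then have "r \<le> card ({u\<in>{..<m}. {v, u} \<in> E} \<union> {m..<n})"
        unfolding deg(1)[symmetric] by (intro card_mono) auto
      also have "\<dots> \<le> card {u\<in>{..<m}. {v, u} \<in> E} + card {m..<n}" by (rule card_Un_le)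
      finally have 2: "r \<le> card {u\<in>{..<m}. {v, u} \<in> E} + 2 ^ l" using m by simp
      have "\<bar>real (card {u\<in>{..<m}. {v, u} \<in> E}) - real r\<bar> \<le> real (2 ^ l)"
        using 1 2 by linarith
      also have "\<dots> \<le> sqrt (real r)" using l1 by simp
      finally have "\<bar>real (card {u\<in>{..<m}. {v, u} \<in> E}) - real r\<bar>\<^sup>2 \<le> (sqrt (real r))\<^sup>2"
        by (intro power_mono) auto
      then show "(real (card {u\<in>{..<m}. {v, u} \<in> E}) - real r)\<^sup>2 \<le> real r" by simp
    qed
    finally show ?thesis by simp
  qed
  have mr: "real m * real r \<ge> 0" by simp
  have "sqrt (real r) \<ge> sqrt (4\<^sup>2)" using False by (intro real_sqrt_le_mono) simp
  then have s4: "sqrt (real r) \<ge> 4" by simp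
  have "2 ^ (l + 1) \<le> 2 * sqrt (real r)" using l1 by simp
  also have "\<dots> \<le> sqrt (real r) * sqrt (real r)" using s4 by (intro mult_right_mono) auto
  finally have d: "2 ^ (l + 1) \<le> real r" by simp
  have "end_energy E last P (real r) + end_energy E hd P (real r) \<le> 64 * real (card P) * real r"
  proof -
    have "end_energy E last P (real r) \<le> real m * real r" "end_energy E hd P (real r) \<le> real m * real r"
      by (rule en, simp)+
    then show ?thesis using mr unfolding cardP mult.assoc by linarith
  qed
  from join_paths[OF ps _ d all_pairs_not_singleton[OF E] this, of q]
  obtain zs where zs: "distinct zs" "set zs = \<Union>(set ` P)"
     "real (defects E zs) \<le> real (\<Sum>p\<in>P. defects E p) + 50 * real m / sqrt (real r) + real q"
    using cardP by (auto simp: m_def)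
  have setzs: "set zs = {..<m}" using zs(2) by (auto simp: P_def)
  have "(\<Sum>p\<in>P. defects E p) = 0" by (auto simp: P_def)
  then have zs3: "real (defects E zs) \<le> 50 * real m / sqrt (real r) + real q" using zs(3) by simp
  let ?zs = "zs @ [m..<n]"
  have "real (defects E ?zs) \<le> real (defects E zs) + real (n - m)"
    using defects_append_le[of E zs "[m..<n]"] by simp
  moreover have "real (n - m) \<le> real n / sqrt (real r)"
  proof -
    have "real (n - m) \<le> real (2 ^ l)" using m(2) by (intro of_nat_mono) simp
    also have "\<dots> \<le> sqrt (real r)" using l1 by simp
    also have "\<dots> \<le> real n / sqrt (real r)"
    proof -
      have "sqrt (real r) * sqrt (real r) \<le> real n" using rr regular_graph_degree_le[OF G n] by simp
      then show ?thesis using r by (simp add: pos_le_divide_eq)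
    qed
    finally show ?thesis .
  qed
  moreover have "real q \<le> 2 * (real n / sqrt (real r))"
  proof -
    have "real q * 2 ^ l \<le> real n"
      unfolding q_def using of_nat_mono[OF div_times_less_eq_dividend[of n "2 ^ l"], where 'a = real] by simp
    moreover have "real q * sqrt (real r) \<le> real q * (2 * 2 ^ l)" using l2 by (intro mult_left_mono) auto
    ultimately have "real q * sqrt (real r) \<le> 2 * real n" by linarith
    then show ?thesis using r by (simp add: field_simps)
  qed
  moreover have "50 * real m / sqrt (real r) \<le> 50 * (real n / sqrt (real r))"
    using m s4 by (simp add: divide_right_mono)
  ultimately have "real (defects E ?zs) \<le> 53 * (real n / sqrt (real r))"
    using zs3 by linarith
  moreover have "distinct ?zs" using zs(1) setzs by (simp add: ivl_disj_int_one(2))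
  moreover have "set ?zs = {..<n}" using setzs ivl_disj_un_one(2)[OF m(1)] by simp
  ultimately show ?thesis by (intro exI[of _ ?zs] conjI)
qed

section \<open>Rotations and boosters\<close>

definition vertex_ordering :: "nat \<Rightarrow> nat list \<Rightarrow> bool" where
  "vertex_ordering n vs \<longleftrightarrow> distinct vs \<and> set vs = {..<n}"

lemma vertex_ordering_length: "vertex_ordering n vs \<Longrightarrow> length vs = n"
  unfolding vertex_ordering_def using distinct_card by fastforce

lemma vertex_ordering_not_Nil: "vertex_ordering n vs \<Longrightarrow> n > 0 \<Longrightarrow> vs \<noteq> []"
  using vertex_ordering_length by fastforce

definition cyc_defects :: "'a set set \<Rightarrow> 'a list \<Rightarrow> nat" where
  "cyc_defects E vs = defects E vs + of_bool ({last vs, hd vs} \<notin> E)"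

lemma hamiltonian_if_no_cyc_defects:
  assumes "vertex_ordering n vs" "cyc_defects E vs = 0" "n \<ge> 3"
  shows "hamiltonian n E"
proof -
  have len: "length vs = n" using assms vertex_ordering_length by blast
  have d: "defects E vs = 0" "{last vs, hd vs} \<in> E"
    using assms(2) by (auto simp: cyc_defects_def of_bool_def split: if_splits)
  have "{vs ! i, vs ! ((i + 1) mod length vs)} \<in> E" if "i < length vs" for i
  proof (cases "Suc i < length vs")
    case True
    then show ?thesis using defects_zero_nth[OF d(1) True] by simp
  next
    case False
    then have i: "i + 1 = length vs" "i = length vs - 1" using that by auto
    have "vs \<noteq> []" using that by auto
    then have "vs ! i = last vs" "vs ! 0 = hd vs" using i by (simp_all add: last_conv_nth hd_conv_nth)
    then show ?thesis using d(2) i(1) by simp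
  qed
  then show ?thesis using assms len unfolding hamiltonian_def vertex_ordering_def by (intro exI[of _ vs]) auto
qed

text \<open>Quantifying over all \<open>E'\<close> above \<open>E\<close> makes the property survive
  the addition of random edges: rotations will use edges of \<open>E\<close>, while defects are
  counted in \<open>E'\<close>. Keeping \<open>last vs\<close> fixed allows a second application to
  the reversed ordering.\<close>

definition rotatable :: "nat \<Rightarrow> nat \<Rightarrow> nat set set \<Rightarrow> bool" where
  "rotatable n u E \<longleftrightarrow> (\<forall>E' vs. E \<subseteq> E' \<longrightarrow> vertex_ordering n vs \<longrightarrow>
     (\<exists>U. u \<le> card U \<and> (\<forall>a\<in>U. \<exists>ws. vertex_ordering n ws \<and> hd ws = a \<and> last ws = last vs \<and>
        defects E' ws \<le> defects E' vs)))"

text \<open>The pair \<open>last xs\<close>, \<open>x\<close> is exchanged for \<open>hd xs\<close>,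
  \<open>x\<close>, which is an edge. Whether the lost pair was adjacent does not matter, so
  rotations also work on orderings with defects.\<close>

lemma rotation_defects:
  assumes "xs \<noteq> []" "{hd xs, x} \<in> E"
  shows "defects E (rev xs @ x # ys) \<le> defects E (xs @ x # ys)"
  using assms by (simp add: defects_append defects_rev last_rev)

text \<open>Each neighbour \<open>x\<close> of the head allows one rotation, whose new head is the
  predecessor of \<open>x\<close> in \<open>vs\<close>; distinct vertices have distinct
  predecessors, which gives \<open>r\<close> heads.\<close>

lemma regular_graph_rotatable:
  assumes G: "regular_graph n r E" and n: "n > 0"
  shows "rotatable n r E"
  unfolding rotatable_def
proof (intro allI impI)
  fix E' vs assume E': "E \<subseteq> E'" and vs: "vertex_ordering n vs"
  define a where "a = hd vs"
  have "vs \<noteq> []" using vs n vertex_ordering_not_Nil by blast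
  then have "a \<in> set vs" by (simp add: a_def)
  then have an: "a < n" using vs by (auto simp: vertex_ordering_def)
  have E: "E \<subseteq> all_pairs n" using G by (simp add: regular_graph_def)
  have "\<exists>xs ys. vs = xs @ x # ys \<and> xs \<noteq> []" if "{a, x} \<in> E" for x
  proof -
    have "x \<noteq> a" using that all_pairs_not_singleton[OF E] by auto
    moreover have "x \<in> set vs" using that regular_graph_degree(2)[OF G an] vs by (auto simp: vertex_ordering_def)
    then obtain xs ys where xs: "vs = xs @ x # ys" by (metis split_list)
    ultimately have "xs \<noteq> []" by (auto simp: a_def)
    then show ?thesis using xs by blast
  qed
  then obtain f g where fg: "\<And>x. {a, x} \<in> E \<Longrightarrow> vs = f x @ x # g x" "\<And>x. {a, x} \<in> E \<Longrightarrow> f x \<noteq> []"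
    by metis
  let ?N = "{x. {a, x} \<in> E}"
  have "inj_on (\<lambda>x. last (f x)) ?N"
  proof (rule inj_onI)
    fix x y assume xy: "x \<in> ?N" "y \<in> ?N" "last (f x) = last (f y)"
    have dist: "distinct vs" using vs by (simp add: vertex_ordering_def)
    have eq: "vs = butlast (f z) @ last (f z) # z # g z" if "z \<in> ?N" for z
      using fg[of z] that by (metis append_Cons append_Nil append_assoc append_butlast_last_id mem_Collect_eq)
    have "butlast (f x) @ last (f x) # x # g x = butlast (f y) @ last (f x) # y # g y"
      using eq[OF xy(1)] eq[OF xy(2)] xy(3) by simp
    moreover have "distinct (butlast (f x) @ last (f x) # x # g x)" using eq[OF xy(1)] dist by simp
    moreover have "distinct (butlast (f y) @ last (f x) # y # g y)" using eq[OF xy(2)] dist xy(3) by simp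
    ultimately have "x # g x = y # g y"
      by (metis append_Cons_eq_iff distinct.simps(2) distinct_append not_distinct_conv_prefix)
    then show "x = y" by simp
  qed
  then have "card ((\<lambda>x. last (f x)) ` ?N) = r"
    using regular_graph_degree(1)[OF G an] by (simp add: card_image)
  moreover have "\<exists>ws. vertex_ordering n ws \<and> hd ws = last (f x) \<and> last ws = last vs \<and> defects E' ws \<le> defects E' vs"
    if "x \<in> ?N" for x
  proof (intro exI conjI)
    have x: "vs = f x @ x # g x" "f x \<noteq> []" using fg that by auto
    show "vertex_ordering n (rev (f x) @ x # g x)"
      using vs x(1) unfolding vertex_ordering_def by (metis distinct_append distinct_rev set_append set_rev)
    show "hd (rev (f x) @ x # g x) = last (f x)" using x by (simp add: hd_rev)
    show "last (rev (f x) @ x # g x) = last vs" using x by (metis last_appendR list.distinct(1))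
    have "hd (f x) = a" using x by (metis a_def hd_append2)
    then show "defects E' (rev (f x) @ x # g x) \<le> defects E' vs"
      using rotation_defects[OF x(2), of x E' "g x"] that E' x(1) by auto
  qed
  ultimately show "\<exists>U. r \<le> card U \<and> (\<forall>a\<in>U. \<exists>ws. vertex_ordering n ws \<and> hd ws = a \<and> last ws = last vs \<and>
      defects E' ws \<le> defects E' vs)"
    by (intro exI[of _ "(\<lambda>x. last (f x)) ` ?N"]) auto
qed

section \<open>Iterated rotations and Posa's lemma\<close>

fun path_edges :: "'a list \<Rightarrow> 'a set set" where
  "path_edges [] = {}"
| "path_edges [x] = {}"
| "path_edges (x # y # zs) = insert {x, y} (path_edges (y # zs))"

lemma path_edges_append:
  "xs \<noteq> [] \<Longrightarrow> ys \<noteq> [] \<Longrightarrow> path_edges (xs @ ys) = insert {last xs, hd ys} (path_edges xs \<union> path_edges ys)"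
proof (induction xs rule: path_edges.induct)
  case (2 x)
  then show ?case by (cases ys) auto
qed auto

lemma path_edges_rev: "path_edges (rev xs) = path_edges xs"
proof (induction xs rule: path_edges.induct)
  case (3 x y zs)
  have "path_edges (rev (x # y # zs)) = path_edges (rev (y # zs) @ [x])" by simp
  also have "\<dots> = insert {y, x} (path_edges (rev (y # zs)))"
    by (subst path_edges_append) auto
  finally show ?case using 3 by (simp add: insert_commute)
qed auto

lemma path_edges_subset: "e \<in> path_edges xs \<Longrightarrow> e \<subseteq> set xs"
  by (induction xs rule: path_edges.induct) auto

lemma card_path_nbrs_le:
  assumes "distinct vs"
  shows "finite {v. {v, w} \<in> path_edges vs}" "card {v. {v, w} \<in> path_edges vs} \<le> 2"
proof -
  have "\<exists>a b. {v. {v, w} \<in> path_edges vs} \<subseteq> {a, b}"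
  proof (cases "w \<in> set vs")
    case True
    then obtain as bs where vs: "vs = as @ w # bs" by (metis split_list)
    have w: "w \<notin> set as" "w \<notin> set bs" using assms vs by auto
    have 1: "path_edges (w # bs) \<subseteq> insert {w, hd bs} (path_edges bs)" by (cases bs) auto
    have 2: "path_edges vs \<subseteq> insert {last as, w} (path_edges as \<union> path_edges (w # bs))"
      unfolding vs by (cases "as = []") (auto simp: path_edges_append)
    have "v \<in> {last as, hd bs}" if "{v, w} \<in> path_edges vs" for v
    proof -
      have "{v, w} \<notin> path_edges as" "{v, w} \<notin> path_edges bs" using w path_edges_subset by blast+
      then have "{v, w} = {last as, w} \<or> {v, w} = {w, hd bs}" using 1 2 that by blast
      then show ?thesis by (auto simp: doubleton_eq_iff)
    qed
    then show ?thesis by blast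
  next
    case False
    then have "{v. {v, w} \<in> path_edges vs} = {}" using path_edges_subset by fastforce
    then show ?thesis by blast
  qed
  then obtain a b where ab: "{v. {v, w} \<in> path_edges vs} \<subseteq> {a, b}" by blast
  show "finite {v. {v, w} \<in> path_edges vs}" using ab finite_subset by blast
  have "card {v. {v, w} \<in> path_edges vs} \<le> card {a, b}" using ab by (intro card_mono) auto
  also have "\<dots> \<le> 2" by (simp add: card_insert_if)
  finally show "card {v. {v, w} \<in> path_edges vs} \<le> 2" .
qed

inductive rotations :: "'a set set \<Rightarrow> 'a list \<Rightarrow> 'a list \<Rightarrow> bool" for E vs where
  rotations_refl: "rotations E vs vs"
| rotations_step: "rotations E vs (xs @ x # ys) \<Longrightarrow> xs \<noteq> [] \<Longrightarrow> {hd xs, x} \<in> E \<Longrightarrow> rotations E vs (rev xs @ x # ys)"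

lemma rotations_invariant:
  assumes "rotations E vs ws" "E \<subseteq> E'"
  shows "set ws = set vs \<and> length ws = length vs \<and> last ws = last vs \<and> defects E' ws \<le> defects E' vs"
  using assms(1)
proof (induction rule: rotations.induct)
  case (rotations_step xs x ys)
  have "defects E' (rev xs @ x # ys) \<le> defects E' (xs @ x # ys)"
    using rotations_step.hyps assms(2) by (intro rotation_defects) auto
  then show ?case using rotations_step.IH by auto
qed auto

definition nbhd :: "'a set set \<Rightarrow> 'a set \<Rightarrow> 'a set" where
  "nbhd E S = {v. \<exists>u\<in>S. {u, v} \<in> E} - S"

text \<open>Posa's lemma: a vertex at distance at least two (along the original path) from all reachable
  endpoints never loses a path edge, so rotating at it would make one of its path neighbours an endpoint.\<close>
lemma nbhd_rotation_ends:
  assumes vs: "vs \<noteq> []" and E: "\<And>u v. {u, v} \<in> E \<Longrightarrow> v \<in> set vs \<and> u \<noteq> v"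
    and U: "U = {hd ws | ws. rotations E vs ws}"
  shows "nbhd E U \<subseteq> (\<Union>w\<in>U. {v. {v, w} \<in> path_edges vs})"
proof
  fix v assume v: "v \<in> nbhd E U"
  show "v \<in> (\<Union>w\<in>U. {v. {v, w} \<in> path_edges vs})"
  proof (rule ccontr)
    assume "v \<notin> (\<Union>w\<in>U. {v. {v, w} \<in> path_edges vs})"
    then have far: "w \<notin> U" if "{v, w} \<in> path_edges vs" for w using that by blast
    have vU: "v \<notin> U" using v by (simp add: nbhd_def)
    have keep: "{v, w} \<in> path_edges ws \<longleftrightarrow> {v, w} \<in> path_edges vs" if "rotations E vs ws" for ws w
      using that
    proof (induction arbitrary: w rule: rotations.induct)
      case (rotations_step xs x ys)
      have old: "path_edges (xs @ x # ys) = insert {last xs, x} (path_edges xs \<union> path_edges (x # ys))"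
        using rotations_step.hyps by (simp add: path_edges_append)
      have new: "path_edges (rev xs @ x # ys) = insert {hd xs, x} (path_edges xs \<union> path_edges (x # ys))"
        using rotations_step.hyps by (simp add: path_edges_append path_edges_rev last_rev)
      have "hd (xs @ x # ys) \<in> U" using rotations_step.hyps(1) U by blast
      then have 1: "hd xs \<in> U" using rotations_step.hyps by simp
      have "hd (rev xs @ x # ys) \<in> U" using rotations.rotations_step[OF rotations_step.hyps] U by blast
      then have 2: "last xs \<in> U" using rotations_step.hyps by (simp add: hd_rev)
      \<comment> \<open>If \<open>v\<close> were the pivot, \<open>last xs\<close>, which becomes an
        endpoint, would be next to \<open>v\<close> in the current ordering and hence, by induction,
        in the original one.\<close>
      have 3: "v \<noteq> x"
      proof
        assume "v = x"
        then have "{v, last xs} \<in> path_edges (xs @ x # ys)" unfolding old by (simp add: insert_commute)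
        then show False using rotations_step.IH far 2 by blast
      qed
      have "{v, w} \<noteq> {hd xs, x}" "{v, w} \<noteq> {last xs, x}"
        using 1 2 3 vU by (auto simp: doubleton_eq_iff)
      then show ?case using rotations_step.IH[of w] unfolding old new by simp
    qed simp
    obtain ws where ws: "rotations E vs ws" "{hd ws, v} \<in> E"
      using v U by (auto simp: nbhd_def)
    have set: "set ws = set vs" using rotations_invariant[OF ws(1) subset_refl] by simp
    then have "v \<in> set ws" "hd ws \<noteq> v" using E ws(2) by auto
    then obtain xs ys where xs: "ws = xs @ v # ys" "xs \<noteq> []"
      by (metis append_Nil list.sel(1) split_list)
    then have "rotations E vs (rev xs @ v # ys)" using ws by (intro rotations.rotations_step) auto
    then have "hd (rev xs @ v # ys) \<in> U" using U by blast
    then have "last xs \<in> U" using xs by (simp add: hd_rev)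
    moreover have "{v, last xs} \<in> path_edges ws"
      using xs by (simp add: path_edges_append insert_commute)
    ultimately show False using keep[OF ws(1)] far by blast
  qed
qed

definition expander :: "nat \<Rightarrow> nat set set \<Rightarrow> bool" where
  "expander n E \<longleftrightarrow> (\<forall>S\<subseteq>{..<n}. S \<noteq> {} \<longrightarrow> card S \<le> n div 4 \<longrightarrow> 2 * card S < card (nbhd E S))"

text \<open>By \<open>nbhd_rotation_ends\<close> every outside neighbour of the endpoint set
  \<open>U\<close> is next to a member of \<open>U\<close> in the original ordering, and each member
  has at most two such vertices. So \<open>card (nbhd E U) \<le> 2 * card U\<close>, which the
  strict inequality of \<open>expander\<close> forbids for sets of size up to
  \<open>n div 4\<close>.\<close>

lemma expander_rotatable:
  assumes exp: "expander n E" and E: "E \<subseteq> all_pairs n" and n: "n > 0"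
  shows "rotatable n (n div 4 + 1) E"
  unfolding rotatable_def
proof (intro allI impI)
  fix E' vs assume E': "E \<subseteq> E'" and vs: "vertex_ordering n vs"
  have ne: "vs \<noteq> []" using vs n vertex_ordering_not_Nil by blast
  define U where "U = {hd ws | ws. rotations E vs ws}"
  have dist: "distinct vs" "set vs = {..<n}" using vs by (auto simp: vertex_ordering_def)
  have rot: "vertex_ordering n ws" "last ws = last vs" "defects E' ws \<le> defects E' vs" "ws \<noteq> []"
    if "rotations E vs ws" for ws
  proof -
    note inv = rotations_invariant[OF that E']
    have "card (set ws) = length ws" using inv distinct_card[OF dist(1)] by simp
    then have "distinct ws" by (rule card_distinct)
    then show "vertex_ordering n ws" using inv dist(2) by (simp add: vertex_ordering_def)
    show "ws \<noteq> []" using inv ne by auto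
  qed (use rotations_invariant[OF that E'] in simp_all)
  have "U \<subseteq> {..<n}" unfolding U_def using rot(1,4) hd_in_set by (fastforce simp: vertex_ordering_def)
  moreover have "hd vs \<in> U" unfolding U_def using rotations.rotations_refl by blast
  moreover have "card (nbhd E U) \<le> 2 * card U"
  proof -
    have finU: "finite U" using \<open>U \<subseteq> {..<n}\<close> finite_subset by blast
    have "nbhd E U \<subseteq> (\<Union>w\<in>U. {v. {v, w} \<in> path_edges vs})"
    proof (rule nbhd_rotation_ends[OF ne _ U_def])
      fix u v assume uv: "{u, v} \<in> E"
      then have "{u, v} \<in> all_pairs n" using E by blast
      then have "{u, v} \<subseteq> {..<n}" "card {u, v} = 2" unfolding all_pairs_def by blast+
      then show "v \<in> set vs \<and> u \<noteq> v" unfolding dist(2) by (cases "u = v") simp_all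
    qed
    moreover have "finite (\<Union>w\<in>U. {v. {v, w} \<in> path_edges vs})"
      by (intro finite_UN_I finU card_path_nbrs_le[OF dist(1)])
    ultimately have "card (nbhd E U) \<le> card (\<Union>w\<in>U. {v. {v, w} \<in> path_edges vs})"
      by (intro card_mono)
    also have "\<dots> \<le> (\<Sum>w\<in>U. card {v. {v, w} \<in> path_edges vs})" by (rule card_UN_le[OF finU])
    also have "\<dots> \<le> (\<Sum>w\<in>U. 2)" by (intro sum_mono card_path_nbrs_le[OF dist(1)])
    finally show ?thesis by simp
  qed
  ultimately have "U \<subseteq> {..<n}" "U \<noteq> {}" "\<not> 2 * card U < card (nbhd E U)" by auto
  then have "\<not> card U \<le> n div 4" using exp unfolding expander_def by blast
  then have "n div 4 + 1 \<le> card U" by simp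
  then show "\<exists>U. n div 4 + 1 \<le> card U \<and> (\<forall>a\<in>U. \<exists>ws. vertex_ordering n ws \<and> hd ws = a \<and> last ws = last vs \<and>
      defects E' ws \<le> defects E' vs)"
    using rot by (intro exI[of _ U]) (auto simp: U_def)
qed

section \<open>Boosters and certificates of non-Hamiltonicity\<close>

lemma defects_pos_split:
  "defects E vs > 0 \<Longrightarrow> \<exists>xs ys. vs = xs @ ys \<and> xs \<noteq> [] \<and> ys \<noteq> [] \<and> {last xs, hd ys} \<notin> E"
proof (induction E vs rule: defects.induct)
  case (3 E x y zs)
  show ?case
  proof (cases "{x, y} \<in> E")
    case True
    with 3 obtain xs ys where "y # zs = xs @ ys" "xs \<noteq> []" "ys \<noteq> []" "{last xs, hd ys} \<notin> E" by auto
    then show ?thesis by (intro exI[of _ "x # xs"] exI[of _ ys]) auto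
  next
    case False
    then show ?thesis by (intro exI[of _ "[x]"] exI[of _ "y # zs"]) auto
  qed
qed auto

text \<open>A cyclic shift moves a defect to the seam between last and first entry, where
  \<open>defects\<close> does not count it.\<close>

lemma open_at_defect:
  assumes "vertex_ordering n vs" "cyc_defects E vs = Suc k"
  shows "\<exists>ws. vertex_ordering n ws \<and> defects E ws \<le> k"
proof (cases "{last vs, hd vs} \<in> E")
  case True
  then have "defects E vs = Suc k" using assms by (simp add: cyc_defects_def)
  then obtain xs ys where xy: "vs = xs @ ys" "xs \<noteq> []" "ys \<noteq> []" "{last xs, hd ys} \<notin> E"
    using defects_pos_split[of E vs] by auto
  have "Suc k = defects E xs + 1 + defects E ys"
    using \<open>defects E vs = Suc k\<close> xy by (simp add: defects_append)
  moreover have "defects E (ys @ xs) = defects E xs + defects E ys"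
    using True xy by (simp add: defects_append)
  moreover have "vertex_ordering n (ys @ xs)" using assms xy by (auto simp: vertex_ordering_def)
  ultimately show ?thesis by (intro exI[of _ "ys @ xs"]) auto
next
  case False
  then show ?thesis using assms by (intro exI[of _ vs]) (auto simp: cyc_defects_def)
qed

text \<open>Rotating the head gives \<open>u\<close> choices of one end \<open>a\<close>; reversing
  and rotating again with \<open>a\<close> held fixed gives \<open>u\<close> choices of the other
  end \<open>b\<close>. The edge \<open>{a, b}\<close> closes the ordering without a new defect. An
  unordered pair arises from at most two ordered ones, whence the factor \<open>2\<close>.\<close>

lemma boosters:
  assumes rot: "rotatable n u \<Gamma>" and sub: "\<Gamma> \<subseteq> E" and n: "n \<ge> 2"
    and vs: "vertex_ordering n vs" "defects E vs \<le> k"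
  shows "\<exists>B\<subseteq>all_pairs n. u * u \<le> 2 * card B \<and>
    (\<forall>e\<in>B. \<exists>ws. vertex_ordering n ws \<and> cyc_defects (insert e E) ws \<le> k)"
proof -
  have rot': "\<exists>U. u \<le> card U \<and> (\<forall>a\<in>U. \<exists>ws. vertex_ordering n ws \<and> hd ws = a \<and> last ws = last vs \<and>
        defects E ws \<le> defects E vs)" if "vertex_ordering n vs" for vs
    using rot sub that unfolding rotatable_def by blast
  obtain U where U: "u \<le> card U" "\<And>a. a \<in> U \<Longrightarrow> \<exists>ws. vertex_ordering n ws \<and> hd ws = a \<and> defects E ws \<le> k"
    using rot'[OF vs(1)] vs(2) by (meson order_trans)
  have "\<exists>W. u \<le> card W \<and> (\<forall>b\<in>W. \<exists>ws. vertex_ordering n ws \<and> hd ws = b \<and> last ws = a \<and> defects E ws \<le> k)"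
    if "a \<in> U" for a
  proof -
    obtain ws where ws: "vertex_ordering n ws" "hd ws = a" "defects E ws \<le> k" using U(2) \<open>a \<in> U\<close> by blast
    have "vertex_ordering n (rev ws)" using ws by (simp add: vertex_ordering_def)
    from rot'[OF this] ws show ?thesis by (metis (no_types, lifting) defects_rev last_rev order_trans)
  qed
  then obtain W where W: "\<And>a. a \<in> U \<Longrightarrow> u \<le> card (W a)"
    "\<And>a b. a \<in> U \<Longrightarrow> b \<in> W a \<Longrightarrow> \<exists>ws. vertex_ordering n ws \<and> hd ws = b \<and> last ws = a \<and> defects E ws \<le> k"
    by metis
  have ends: "a < n" "b < n" "a \<noteq> b" if "a \<in> U" "b \<in> W a" for a b
  proof -
    obtain ws where ws: "vertex_ordering n ws" "hd ws = b" "last ws = a" using W(2) \<open>a \<in> U\<close> \<open>b \<in> W a\<close> by blast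
    have len: "length ws \<ge> 2" using n vertex_ordering_length[OF ws(1)] by simp
    then have "ws \<noteq> []" by auto
    then have "a \<in> set ws" "b \<in> set ws" using ws(2,3) by auto
    then show "a < n" "b < n" using ws(1) by (simp_all add: vertex_ordering_def)
    obtain x y zs where xyz: "ws = x # y # zs" using len by (metis Suc_le_length_iff numeral_2_eq_2)
    have "x \<notin> set (y # zs)" using ws(1) unfolding xyz vertex_ordering_def by simp
    moreover have "last (y # zs) \<in> set (y # zs)" by (rule last_in_set) simp
    moreover have "a = last (y # zs)" "b = x" using ws(2,3) unfolding xyz by simp_all
    ultimately show "a \<noteq> b" by metis
  qed
  have finW: "finite (W a)" if "a \<in> U" for a
    using ends that by (intro finite_subset[of "W a" "{..<n}"]) auto
  have finU: "finite U"
  proof -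
    have "a < n" if "a \<in> U" for a
    proof -
      obtain ws where "vertex_ordering n ws" "hd ws = a" using U(2) \<open>a \<in> U\<close> by blast
      then show ?thesis using vertex_ordering_not_Nil[of n ws] n hd_in_set[of ws] by (auto simp: vertex_ordering_def)
    qed
    then show ?thesis by (intro finite_subset[of U "{..<n}"]) auto
  qed
  define S where "S = (SIGMA a:U. W a)"
  have finS: "finite S" unfolding S_def using finU finW by auto
  define B where "B = (\<lambda>(a, b). {a, b}) ` S"
  have "u * u \<le> card S"
  proof -
    have "u * u \<le> card U * u" using U(1) by simp
    also have "\<dots> = (\<Sum>a\<in>U. u)" by simp
    also have "\<dots> \<le> (\<Sum>a\<in>U. card (W a))" using W(1) by (intro sum_mono)
    also have "\<dots> = card S" unfolding S_def using finU finW by simp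
    finally show ?thesis .
  qed
  also have "card S \<le> card (\<Union>e\<in>B. {(a, b). {a, b} = e \<and> (a, b) \<in> S})"
    by (rule eq_refl, rule arg_cong[where f = card]) (auto simp: B_def)
  also have "\<dots> \<le> (\<Sum>e\<in>B. card {(a, b). {a, b} = e \<and> (a, b) \<in> S})"
    using finS by (intro card_UN_le) (auto simp: B_def)
  also have "\<dots> \<le> (\<Sum>e\<in>B. 2)"
  proof (rule sum_mono)
    fix e assume "e \<in> B"
    then obtain x y where e: "e = {x, y}" by (auto simp: B_def)
    then have "{(a, b). {a, b} = e \<and> (a, b) \<in> S} \<subseteq> {(x, y), (y, x)}" by (auto simp: doubleton_eq_iff)
    then have "card {(a, b). {a, b} = e \<and> (a, b) \<in> S} \<le> card {(x, y), (y, x)}" by (intro card_mono) auto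
    also have "\<dots> \<le> 2" using card_length[of "[(x, y), (y, x)]"] by simp
    finally show "card {(a, b). {a, b} = e \<and> (a, b) \<in> S} \<le> 2" .
  qed
  finally have "u * u \<le> 2 * card B" by simp
  moreover have "B \<subseteq> all_pairs n" using ends by (auto simp: B_def S_def all_pairs_def)
  moreover have "\<exists>ws. vertex_ordering n ws \<and> cyc_defects (insert e E) ws \<le> k" if "e \<in> B" for e
  proof -
    obtain a b where ab: "e = {a, b}" "a \<in> U" "b \<in> W a" using \<open>e \<in> B\<close> by (auto simp: B_def S_def)
    obtain ws where ws: "vertex_ordering n ws" "hd ws = b" "last ws = a" "defects E ws \<le> k"
      using W(2) ab by blast
    have "cyc_defects (insert e E) ws = defects (insert e E) ws"
      using ws ab by (simp add: cyc_defects_def)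
    also have "\<dots> \<le> defects E ws" by (rule defects_mono) auto
    finally show ?thesis using ws by auto
  qed
  ultimately show ?thesis by blast
qed

definition min_cyc_defects :: "nat \<Rightarrow> nat set set \<Rightarrow> nat" where
  "min_cyc_defects n E = (LEAST k. \<exists>vs. vertex_ordering n vs \<and> cyc_defects E vs = k)"

lemma min_cyc_defects_le: "vertex_ordering n vs \<Longrightarrow> min_cyc_defects n E \<le> cyc_defects E vs"
  unfolding min_cyc_defects_def by (intro Least_le) auto

lemma min_cyc_defects_attained: "\<exists>vs. vertex_ordering n vs \<and> cyc_defects E vs = min_cyc_defects n E"
proof -
  have "vertex_ordering n [0..<n]" by (auto simp: vertex_ordering_def)
  then have "\<exists>k vs. vertex_ordering n vs \<and> cyc_defects E vs = k" by blast
  then show ?thesis unfolding min_cyc_defects_def by (rule LeastI_ex)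
qed

lemma booster_sets:
  assumes rot: "rotatable n u \<Gamma>" and sub: "\<Gamma> \<subseteq> E" and n: "n \<ge> 2" and m: "min_cyc_defects n E > 0"
  shows "\<exists>B\<subseteq>all_pairs n. u * u \<le> 2 * card B \<and> (\<forall>e\<in>B. min_cyc_defects n (insert e E) < min_cyc_defects n E)"
proof -
  obtain k where k: "min_cyc_defects n E = Suc k" using m gr0_implies_Suc by blast
  obtain vs where "vertex_ordering n vs" "cyc_defects E vs = Suc k" using min_cyc_defects_attained k by metis
  then obtain ws where "vertex_ordering n ws" "defects E ws \<le> k" using open_at_defect by blast
  from boosters[OF rot sub n this] obtain B where B: "B \<subseteq> all_pairs n" "u * u \<le> 2 * card B"
    "\<And>e. e \<in> B \<Longrightarrow> \<exists>ws. vertex_ordering n ws \<and> cyc_defects (insert e E) ws \<le> k" by blast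
  have "min_cyc_defects n (insert e E) < min_cyc_defects n E" if "e \<in> B" for e
  proof -
    obtain ws where "vertex_ordering n ws" "cyc_defects (insert e E) ws \<le> k" using B(3) \<open>e \<in> B\<close> by blast
    then show ?thesis using min_cyc_defects_le[of n ws "insert e E"] k by linarith
  qed
  then show ?thesis using B by blast
qed

text \<open>The certificate \<open>R'\<close> has few edges, so the union bound over all certificates is affordable.\<close>
lemma non_hamiltonian_certificate:
  assumes rot: "rotatable n u \<Gamma>" and n: "n \<ge> 3" and vs: "vertex_ordering n vs" "cyc_defects \<Gamma> vs \<le> D"
  shows "\<exists>B. (\<forall>R'. B R' \<subseteq> all_pairs n \<and> B R' \<inter> R' = {}) \<and>
    (\<forall>R. finite R \<longrightarrow> \<not> hamiltonian n (\<Gamma> \<union> R) \<longrightarrow>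
      (\<exists>R'\<subseteq>R. card R' \<le> D \<and> u * u \<le> 2 * card (B R') \<and> B R' \<inter> R = {}))"
proof -
  let ?m = "\<lambda>R. min_cyc_defects n (\<Gamma> \<union> R)"
  \<comment> \<open>An edge already in \<open>R'\<close> cannot cause a strict decrease, so boosters
    avoid \<open>R'\<close>. When no defect is left, the empty set is the default value.\<close>
  have "\<exists>B\<subseteq>all_pairs n. B \<inter> R' = {} \<and> (?m R' > 0 \<longrightarrow> u * u \<le> 2 * card B \<and> (\<forall>e\<in>B. ?m (insert e R') < ?m R'))" for R'
  proof (cases "?m R' > 0")
    case True
    have "\<Gamma> \<subseteq> \<Gamma> \<union> R'" "n \<ge> 2" using n by auto
    from booster_sets[OF rot this True] obtain B where B: "B \<subseteq> all_pairs n" "u * u \<le> 2 * card B"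
      "\<And>e. e \<in> B \<Longrightarrow> ?m (insert e R') < ?m R'" by (metis Un_insert_right)
    have "e \<notin> R'" if "e \<in> B" for e using B(3)[OF that] by (auto simp: insert_absorb)
    then show ?thesis using B by blast
  qed auto
  then obtain B where B: "\<And>R'. B R' \<subseteq> all_pairs n" "\<And>R'. B R' \<inter> R' = {}"
    "\<And>R'. ?m R' > 0 \<Longrightarrow> u * u \<le> 2 * card (B R')"
    "\<And>R' e. ?m R' > 0 \<Longrightarrow> e \<in> B R' \<Longrightarrow> ?m (insert e R') < ?m R'"
    by metis
  have "\<exists>R'\<subseteq>R. card R' \<le> D \<and> u * u \<le> 2 * card (B R') \<and> B R' \<inter> R = {}"
    if fin: "finite R" and nh: "\<not> hamiltonian n (\<Gamma> \<union> R)" for R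
  proof -
    have "?m {} \<le> D" using min_cyc_defects_le[OF vs(1), of \<Gamma>] vs(2) by simp
    then have "{} \<subseteq> R \<and> card {} + ?m {} \<le> D" by simp
    \<comment> \<open>The condition \<open>card S + ?m S \<le> D\<close> says that the edges of
      \<open>S\<close> have paid for themselves by removing defects. Among such subsets of
      \<open>R\<close> one with the fewest remaining defects is taken: a booster of it inside
      \<open>R\<close> could be added and would contradict minimality.\<close>
    from ex_has_least_nat[of "\<lambda>S. S \<subseteq> R \<and> card S + ?m S \<le> D", OF this, of ?m]
    obtain R' where R': "R' \<subseteq> R" "card R' + ?m R' \<le> D"
      and least: "\<And>S. S \<subseteq> R \<Longrightarrow> card S + ?m S \<le> D \<Longrightarrow> ?m R' \<le> ?m S"
      by blast
    have pos: "?m R' > 0"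
    proof (rule ccontr)
      assume "\<not> ?m R' > 0"
      then obtain ws where ws: "vertex_ordering n ws" "cyc_defects (\<Gamma> \<union> R') ws = 0"
        using min_cyc_defects_attained[of n "\<Gamma> \<union> R'"] by auto
      have "defects (\<Gamma> \<union> R) ws \<le> defects (\<Gamma> \<union> R') ws" using R'(1) by (intro defects_mono) auto
      then have "cyc_defects (\<Gamma> \<union> R) ws = 0"
        using ws(2) R'(1) by (auto simp: cyc_defects_def of_bool_def split: if_splits)
      then show False using nh hamiltonian_if_no_cyc_defects[OF ws(1) _ n] by blast
    qed
    have "B R' \<inter> R = {}"
    proof (rule ccontr)
      assume "B R' \<inter> R \<noteq> {}"
      then obtain e where e: "e \<in> B R'" "e \<in> R" by blast
      have "card (insert e R') \<le> Suc (card R')" by (rule card_insert_le_m1) auto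
      then have "card (insert e R') + ?m (insert e R') \<le> D" using B(4)[OF pos e(1)] R'(2) by linarith
      then have "?m R' \<le> ?m (insert e R')" using e R'(1) by (intro least) auto
      then show False using B(4)[OF pos e(1)] by simp
    qed
    then show ?thesis using R' pos B(3) by (intro exI[of _ R']) auto
  qed
  then show ?thesis by (intro exI[of _ B] conjI allI impI B(1,2)) simp_all
qed

section \<open>Random subsets\<close>

definition expect_subset :: "'a set \<Rightarrow> real \<Rightarrow> ('a set \<Rightarrow> real) \<Rightarrow> real" where
  "expect_subset A p f = (\<Sum>R\<in>Pow A. p ^ card R * (1 - p) ^ (card A - card R) * f R)"

lemma expect_subset_empty [simp]: "expect_subset {} p f = f {}"
  by (simp add: expect_subset_def)

lemma expect_subset_insert:
  assumes "finite A" "a \<notin> A"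
  shows "expect_subset (insert a A) p f
    = p * expect_subset A p (\<lambda>R. f (insert a R)) + (1 - p) * expect_subset A p f"
proof -
  let ?w = "\<lambda>R. p ^ card R * (1 - p) ^ (Suc (card A) - card R) * f R"
  have "expect_subset (insert a A) p f = sum ?w (Pow A) + sum ?w (insert a ` Pow A)"
    unfolding expect_subset_def Pow_insert using assms by (subst sum.union_disjoint) auto
  also have "sum ?w (insert a ` Pow A) = (\<Sum>R\<in>Pow A. ?w (insert a R))"
    using assms by (subst sum.reindex) (auto simp: inj_on_def)
  also have "\<dots> = p * expect_subset A p (\<lambda>R. f (insert a R))"
    unfolding expect_subset_def sum_distrib_left
  proof (intro sum.cong refl)
    fix R assume "R \<in> Pow A"
    then have "finite R" "a \<notin> R" using assms finite_subset by auto
    then show "?w (insert a R) = p * (p ^ card R * (1 - p) ^ (card A - card R) * f (insert a R))" by simp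
  qed
  also have "sum ?w (Pow A) = (1 - p) * expect_subset A p f"
    unfolding expect_subset_def sum_distrib_left
  proof (intro sum.cong refl)
    fix R assume "R \<in> Pow A"
    then have "card R \<le> card A" using assms by (auto intro: card_mono)
    then show "?w R = (1 - p) * (p ^ card R * (1 - p) ^ (card A - card R) * f R)" by (simp add: Suc_diff_le)
  qed
  finally show ?thesis by simp
qed

lemma expect_subset_add:
  "expect_subset A p (\<lambda>R. f R + g R) = expect_subset A p f + expect_subset A p g"
  by (simp add: expect_subset_def sum.distrib algebra_simps)

lemma expect_subset_mult:
  "expect_subset A p (\<lambda>R. c * f R) = c * expect_subset A p f"
  by (simp add: expect_subset_def sum_distrib_left algebra_simps)

lemma expect_subset_sum:
  "expect_subset A p (\<lambda>R. \<Sum>i\<in>I. f i R) = (\<Sum>i\<in>I. expect_subset A p (f i))"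
  unfolding expect_subset_def sum_distrib_left by (rule sum.swap)

lemma expect_subset_mono:
  assumes "0 \<le> p" "p \<le> 1" "\<And>R. R \<subseteq> A \<Longrightarrow> f R \<le> g R"
  shows "expect_subset A p f \<le> expect_subset A p g"
  unfolding expect_subset_def using assms by (intro sum_mono mult_left_mono) auto

lemma expect_subset_const: "finite A \<Longrightarrow> expect_subset A p (\<lambda>_. c) = c"
  by (induction A rule: finite_induct) (simp_all add: expect_subset_insert algebra_simps)

text \<open>Two-round exposure: an element misses both rounds with probability
  \<open>(1 - p) * (1 - q)\<close>. Exposing the elements one at a time turns this into an identity
  of polynomials in \<open>p\<close> and \<open>q\<close>.\<close>

lemma expect_subset_union:
  "finite A \<Longrightarrow> expect_subset A p (\<lambda>R. expect_subset A q (\<lambda>S. f (R \<union> S))) = expect_subset A (p + q - p * q) f"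
proof (induction A arbitrary: f rule: finite_induct)
  case (insert a A)
  define F where "F R = expect_subset A q (\<lambda>S. f (insert a (R \<union> S)))" for R
  define H where "H R = expect_subset A q (\<lambda>S. f (R \<union> S))" for R
  have 1: "expect_subset (insert a A) q (\<lambda>S. f (insert a R \<union> S)) = F R" for R
    unfolding expect_subset_insert[OF insert.hyps] F_def by (simp add: algebra_simps)
  have 2: "expect_subset (insert a A) q (\<lambda>S. f (R \<union> S)) = q * F R + (1 - q) * H R" for R
    unfolding expect_subset_insert[OF insert.hyps] F_def H_def by simp
  have 3: "expect_subset A p F = expect_subset A (p + q - p * q) (\<lambda>R. f (insert a R))"
    unfolding F_def by (rule insert.IH)
  have 4: "expect_subset A p H = expect_subset A (p + q - p * q) f"
    unfolding H_def by (rule insert.IH)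
  have "expect_subset (insert a A) p (\<lambda>R. expect_subset (insert a A) q (\<lambda>S. f (R \<union> S)))
      = p * expect_subset A p F + (1 - p) * (q * expect_subset A p F + (1 - q) * expect_subset A p H)"
    unfolding expect_subset_insert[OF insert.hyps, of p] 1 unfolding 2
    by (simp add: expect_subset_add expect_subset_mult)
  also have "\<dots> = expect_subset (insert a A) (p + q - p * q) f"
    unfolding expect_subset_insert[OF insert.hyps] 3 4 by (simp add: algebra_simps)
  finally show ?case .
qed simp

lemma expect_subset_contain_avoid:
  assumes "finite A" "T \<subseteq> A" "F \<subseteq> A" "T \<inter> F = {}"
  shows "expect_subset A p (\<lambda>R. of_bool (T \<subseteq> R \<and> R \<inter> F = {})) = p ^ card T * (1 - p) ^ card F"
  using assms
proof (induction A arbitrary: T F rule: finite_induct)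
  case (insert a A)
  have "finite (insert a A)" using insert.hyps by simp
  then have finTF: "finite T" "finite F" using insert.prems(1,2) finite_subset by metis+
  consider "a \<in> T" "a \<notin> F" | "a \<notin> T" "a \<in> F" | "a \<notin> T" "a \<notin> F" using insert.prems(3) by blast
  then show ?case
  proof cases
    case 1
    have "expect_subset A p (\<lambda>R. of_bool (T \<subseteq> R \<and> R \<inter> F = {})) = expect_subset A p (\<lambda>R. 0)"
      unfolding expect_subset_def using insert 1 by (intro sum.cong) auto
    moreover have "expect_subset A p (\<lambda>R. of_bool (T \<subseteq> insert a R \<and> insert a R \<inter> F = {}))
        = expect_subset A p (\<lambda>R. of_bool (T - {a} \<subseteq> R \<and> R \<inter> F = {}))"
      unfolding expect_subset_def using insert 1 by (intro sum.cong arg_cong2[where f = "(*)"] arg_cong[where f = of_bool]) auto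
    moreover have "\<dots> = p ^ card (T - {a}) * (1 - p) ^ card F" using insert.prems 1 by (intro insert.IH) auto
    moreover have "card T = Suc (card (T - {a}))" using 1 finTF by (metis card.remove)
    ultimately show ?thesis using insert by (simp add: expect_subset_insert expect_subset_const)
  next
    case 2
    have "expect_subset A p (\<lambda>R. of_bool (T \<subseteq> insert a R \<and> insert a R \<inter> F = {})) = expect_subset A p (\<lambda>R. 0)"
      unfolding expect_subset_def using insert 2 by (intro sum.cong) auto
    moreover have "expect_subset A p (\<lambda>R. of_bool (T \<subseteq> R \<and> R \<inter> F = {}))
        = expect_subset A p (\<lambda>R. of_bool (T \<subseteq> R \<and> R \<inter> (F - {a}) = {}))"
      unfolding expect_subset_def using insert 2 by (intro sum.cong arg_cong2[where f = "(*)"] arg_cong[where f = of_bool]) auto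
    moreover have "\<dots> = p ^ card T * (1 - p) ^ card (F - {a})" using insert.prems 2 by (intro insert.IH) auto
    moreover have "card F = Suc (card (F - {a}))" using 2 finTF by (metis card.remove)
    ultimately show ?thesis using insert by (simp add: expect_subset_insert expect_subset_const)
  next
    case 3
    have "(T \<subseteq> insert a R \<and> insert a R \<inter> F = {}) = (T \<subseteq> R \<and> R \<inter> F = {})" for R using 3 by auto
    moreover have "expect_subset A p (\<lambda>R. of_bool (T \<subseteq> R \<and> R \<inter> F = {})) = p ^ card T * (1 - p) ^ card F"
      using insert.prems 3 by (intro insert.IH) auto
    ultimately show ?thesis using insert by (simp add: expect_subset_insert algebra_simps)
  qed
qed simp

lemma expect_subset_union_bound:
  assumes p: "0 \<le> p" "p \<le> 1" and I: "finite I"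
    and Q: "\<And>R. R \<subseteq> A \<Longrightarrow> Q R \<Longrightarrow> \<exists>i\<in>I. Q' i R"
  shows "expect_subset A p (\<lambda>R. of_bool (Q R)) \<le> (\<Sum>i\<in>I. expect_subset A p (\<lambda>R. of_bool (Q' i R)))"
  unfolding expect_subset_sum[symmetric]
proof (rule expect_subset_mono[OF p])
  fix R assume R: "R \<subseteq> A"
  show "(of_bool (Q R) :: real) \<le> (\<Sum>i\<in>I. of_bool (Q' i R))"
  proof (cases "Q R")
    case True
    then obtain i where "i \<in> I" "Q' i R" using Q R by blast
    then show ?thesis using True I member_le_sum[of i I "\<lambda>i. of_bool (Q' i R) :: real"]
      by (simp del: sum_of_bool_eq)
  qed (simp add: sum_nonneg del: sum_of_bool_eq)
qed

section \<open>Counting estimates and the union bound over certificates\<close>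

lemma finite_all_pairs: "finite (all_pairs n)"
  by (rule finite_subset[of _ "Pow {..<n}"]) (auto simp: all_pairs_def)

lemma card_all_pairs_le: "real (card (all_pairs n)) \<le> (real n)\<^sup>2 / 2"
proof -
  have "card (all_pairs n) = n choose 2"
    unfolding all_pairs_def using n_subsets[of "{..<n}" 2] by simp
  also have "\<dots> = n * (n - 1) div 2" by (rule choose_two)
  also have "\<dots> \<le> n * n div 2" by (intro div_le_mono) simp
  finally have "2 * card (all_pairs n) \<le> n * n" by linarith
  then have "real (2 * card (all_pairs n)) \<le> real (n * n)" by (rule of_nat_mono)
  then show ?thesis by (simp add: power2_eq_square)
qed

lemma prob_gnp_expect: "prob_gnp n p Q = expect_subset (all_pairs n) p (\<lambda>R. of_bool (Q R))"
  unfolding prob_gnp_def expect_subset_def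
  by (rule sum.mono_neutral_cong_left) (auto simp: finite_all_pairs)

lemma sum_exp_series_le:
  fixes x :: real
  assumes "x \<ge> 0" "finite J"
  shows "(\<Sum>j\<in>J. x ^ j / fact j) \<le> exp x"
proof -
  have eq: "x ^ j / fact j = x ^ j /\<^sub>R fact j" for j by (simp add: divide_inverse mult.commute)
  show ?thesis unfolding eq exp_def
    using assms by (intro sum_le_suminf summable_exp_generic) auto
qed

lemma binomial_le_pow_div_fact: "real (n choose k) \<le> real n ^ k / fact k"
proof -
  have "real ((n choose k) * fact k) \<le> real (n ^ k)" by (intro of_nat_mono binomial_fact_pow)
  then show ?thesis by (simp add: field_simps)
qed

text \<open>Serves twice, for certificates and for neighbourhoods of small sets; keeping
  \<open>1 / fact j\<close> makes comparison with an exponential series possible.\<close>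

lemma sum_small_subsets_le:
  fixes x :: real
  assumes "finite A" "x \<ge> 0"
  shows "(\<Sum>R\<in>{R. R \<subseteq> A \<and> card R \<le> K}. x ^ card R) \<le> (\<Sum>j\<le>K. (real (card A) * x) ^ j / fact j)"
proof -
  let ?S = "{R. R \<subseteq> A \<and> card R \<le> K}"
  have fin: "finite ?S" using assms by (intro finite_subset[of ?S "Pow A"]) auto
  have "(\<Sum>R\<in>?S. x ^ card R) = (\<Sum>j\<le>K. \<Sum>R\<in>{R\<in>?S. card R = j}. x ^ card R)"
    using fin by (intro sum.group[symmetric]) auto
  also have "\<dots> \<le> (\<Sum>j\<le>K. (real (card A) * x) ^ j / fact j)"
  proof (rule sum_mono)
    fix j assume "j \<in> {..K}"
    then have eq: "{R\<in>?S. card R = j} = {R. R \<subseteq> A \<and> card R = j}" by auto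
    have "(\<Sum>R\<in>{R\<in>?S. card R = j}. x ^ card R) = real (card A choose j) * x ^ j"
      unfolding eq using n_subsets[OF assms(1), of j] by simp
    also have "\<dots> \<le> real (card A) ^ j / fact j * x ^ j"
      using assms by (intro mult_right_mono binomial_le_pow_div_fact) auto
    finally show "(\<Sum>R\<in>{R\<in>?S. card R = j}. x ^ card R) \<le> (real (card A) * x) ^ j / fact j"
      by (simp add: power_mult_distrib)
  qed
  finally show ?thesis .
qed

lemma one_minus_power_le_exp:
  fixes p :: real
  assumes "0 \<le> p" "p \<le> 1"
  shows "(1 - p) ^ m \<le> exp (- p * real m)"
proof -
  have "(1 - p) ^ m \<le> exp (- p) ^ m"
    using assms exp_ge_add_one_self[of "- p"] by (intro power_mono) auto
  also have "\<dots> = exp (- p * real m)" by (simp add: exp_of_nat_mult[symmetric] mult.commute)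
  finally show ?thesis .
qed

text \<open>Containing a certificate \<open>R'\<close> and avoiding its boosters concern disjoint
  sets of pairs, so together they have probability at most
  \<open>p ^ card R' * exp (- p * u^2 / 2)\<close>. Summing \<open>p ^ card R'\<close> gives at most
  the sum of \<open>(t D)^j / j!\<close> over \<open>j \<le> D\<close>; as \<open>t \<ge> 1\<close>,
  pulling out \<open>t powr D\<close> leaves a part of the series of \<open>exp D\<close>. The
  parameter \<open>t\<close> compares the expected number of random edges, at most
  \<open>n^2 p / 2\<close>, with the number of defects.\<close>

lemma rotatable_non_hamiltonian_prob:
  assumes rot: "rotatable n u \<Gamma>" and n: "n \<ge> 3" and vs: "vertex_ordering n vs" "real (cyc_defects \<Gamma> vs) \<le> D"
    and p: "0 \<le> p" "p \<le> 1" and t: "t \<ge> 1" "(real n)\<^sup>2 / 2 * p \<le> t * D"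
  shows "expect_subset (all_pairs n) p (\<lambda>R. of_bool (\<not> hamiltonian n (\<Gamma> \<union> R)))
    \<le> exp (D * (1 + ln t) - p * (real u)\<^sup>2 / 2)"
proof -
  have D0: "D \<ge> 0" using vs(2) of_nat_0_le_iff order_trans by blast
  define K where "K = nat \<lfloor>D\<rfloor>"
  have K: "real K \<le> D" using D0 by (simp add: K_def)
  have "cyc_defects \<Gamma> vs \<le> K" using vs(2) by (simp add: K_def le_nat_floor)
  from non_hamiltonian_certificate[OF rot n vs(1) this] obtain B where
    B: "\<forall>R'. B R' \<subseteq> all_pairs n \<and> B R' \<inter> R' = {}"
    and cert: "\<forall>R. finite R \<longrightarrow> \<not> hamiltonian n (\<Gamma> \<union> R) \<longrightarrow>
      (\<exists>R'\<subseteq>R. card R' \<le> K \<and> u * u \<le> 2 * card (B R') \<and> B R' \<inter> R = {})"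
    by (elim exE conjE) (rule that)
  let ?A = "all_pairs n"
  define C where "C = {R'. R' \<subseteq> ?A \<and> card R' \<le> K \<and> u * u \<le> 2 * card (B R')}"
  have finC: "finite C" unfolding C_def by (rule finite_subset[of _ "Pow ?A"]) (auto simp: finite_all_pairs)
  have "expect_subset ?A p (\<lambda>R. of_bool (\<not> hamiltonian n (\<Gamma> \<union> R)))
      \<le> (\<Sum>R'\<in>C. expect_subset ?A p (\<lambda>R. of_bool (R' \<subseteq> R \<and> R \<inter> B R' = {})))"
  proof (rule expect_subset_union_bound[OF p finC])
    fix R assume R: "R \<subseteq> ?A" "\<not> hamiltonian n (\<Gamma> \<union> R)"
    have "finite R" using R(1) finite_all_pairs finite_subset by blast
    with cert R(2) obtain R' where R': "R' \<subseteq> R" "card R' \<le> K" "u * u \<le> 2 * card (B R')" "B R' \<inter> R = {}"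
      by blast
    then show "\<exists>R'\<in>C. R' \<subseteq> R \<and> R \<inter> B R' = {}" using R(1) unfolding C_def by blast
  qed
  also have "\<dots> \<le> (\<Sum>R'\<in>C. p ^ card R' * exp (- p * (real u)\<^sup>2 / 2))"
  proof (rule sum_mono)
    fix R' assume R': "R' \<in> C"
    have "expect_subset ?A p (\<lambda>R. of_bool (R' \<subseteq> R \<and> R \<inter> B R' = {})) = p ^ card R' * (1 - p) ^ card (B R')"
      using R' spec[OF B, of R'] by (intro expect_subset_contain_avoid finite_all_pairs) (auto simp: C_def)
    also have "\<dots> \<le> p ^ card R' * exp (- p * real (card (B R')))"
      using p by (intro mult_left_mono one_minus_power_le_exp) auto
    also have "exp (- p * real (card (B R'))) \<le> exp (- p * (real u)\<^sup>2 / 2)"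
    proof -
      have "real (u * u) \<le> real (2 * card (B R'))" using R' unfolding C_def by (intro of_nat_mono) auto
      then have "(real u)\<^sup>2 / 2 \<le> real (card (B R'))" by (simp add: power2_eq_square)
      then have "p * ((real u)\<^sup>2 / 2) \<le> p * real (card (B R'))" using p by (intro mult_left_mono)
      then show ?thesis by simp
    qed
    finally show "expect_subset ?A p (\<lambda>R. of_bool (R' \<subseteq> R \<and> R \<inter> B R' = {}))
        \<le> p ^ card R' * exp (- p * (real u)\<^sup>2 / 2)" using p by (simp add: mult_left_mono)
  qed
  also have "\<dots> = (\<Sum>R'\<in>C. p ^ card R') * exp (- p * (real u)\<^sup>2 / 2)" by (simp add: sum_distrib_right)
  also have "\<dots> \<le> exp (D * (1 + ln t)) * exp (- p * (real u)\<^sup>2 / 2)"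
  proof (intro mult_right_mono)
    have "(\<Sum>R'\<in>C. p ^ card R') \<le> (\<Sum>R'\<in>{R. R \<subseteq> ?A \<and> card R \<le> K}. p ^ card R')"
      using p finite_all_pairs
      by (intro sum_mono2) (auto simp: C_def intro: finite_subset[of _ "Pow ?A"])
    also have "\<dots> \<le> (\<Sum>j\<le>K. (real (card ?A) * p) ^ j / fact j)"
      by (rule sum_small_subsets_le[OF finite_all_pairs p(1)])
    also have "\<dots> \<le> (\<Sum>j\<le>K. t powr D * (D ^ j / fact j))"
    proof (rule sum_mono)
      fix j assume j: "j \<in> {..K}"
      have "real (card ?A) * p \<le> (real n)\<^sup>2 / 2 * p" using p by (intro mult_right_mono card_all_pairs_le)
      then have "real (card ?A) * p \<le> t * D" using t(2) by linarith
      then have "(real (card ?A) * p) ^ j \<le> (t * D) ^ j" using p by (intro power_mono) auto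
      also have "\<dots> = t powr real j * D ^ j" using t(1) by (simp add: power_mult_distrib powr_realpow)
      also have "\<dots> \<le> t powr D * D ^ j"
        using t(1) D0 K j by (intro mult_right_mono powr_mono) auto
      finally show "(real (card ?A) * p) ^ j / fact j \<le> t powr D * (D ^ j / fact j)"
        by (simp add: divide_right_mono)
    qed
    also have "\<dots> = t powr D * (\<Sum>j\<le>K. D ^ j / fact j)" by (simp add: sum_distrib_left)
    also have "\<dots> \<le> t powr D * exp D" using D0 by (intro mult_left_mono sum_exp_series_le) auto
    also have "\<dots> = exp (D * (1 + ln t))" using t(1) by (simp add: powr_def exp_add[symmetric] algebra_simps)
    finally show "(\<Sum>R'\<in>C. p ^ card R') \<le> exp (D * (1 + ln t))" .
  qed simp
  also have "\<dots> = exp (D * (1 + ln t) - p * (real u)\<^sup>2 / 2)" by (simp add: exp_add[symmetric])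
  finally show ?thesis .
qed

section \<open>Expansion of the binomial random graph\<close>

text \<open>If \<open>W\<close> is the neighbourhood, some function \<open>\<phi>\<close> from
  \<open>W\<close> to \<open>S\<close> selects a present edge at every \<open>w\<close>, and all
  pairs between \<open>S\<close> and the remaining vertices are absent. The union bound runs over
  the \<open>card S ^ card W\<close> functions, each of which prescribes disjoint sets
  \<open>T \<phi>\<close> of edges and \<open>F\<close> of non-edges.\<close>

lemma prob_nbhd_eq:
  assumes p: "0 \<le> p" "p \<le> 1" and S: "S \<subseteq> {..<n}" and W: "W \<subseteq> {..<n} - S"
  shows "expect_subset (all_pairs n) p (\<lambda>R. of_bool (nbhd R S = W))
    \<le> (real (card S) * p) ^ card W * (1 - p) ^ (card S * (n - card S - card W))"
proof -
  let ?I = "W \<rightarrow>\<^sub>E S"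
  define T where "T \<phi> = (\<lambda>w. {\<phi> w, w}) ` W" for \<phi> :: "nat \<Rightarrow> nat"
  define F where "F = (\<lambda>(a, b). {a, b}) ` (S \<times> ({..<n} - S - W))"
  have fin: "finite S" "finite W" using S W finite_subset by blast+
  have finI: "finite ?I" using fin by (intro finite_PiE) auto
  have cardF: "card F = card S * (n - card S - card W)"
  proof -
    have "inj_on (\<lambda>(a, b). {a, b}) (S \<times> ({..<n} - S - W))"
      by (auto simp: inj_on_def doubleton_eq_iff)
    moreover have "card ({..<n} - S - W) = n - card S - card W"
      using S W fin by (simp add: card_Diff_subset)
    ultimately show ?thesis unfolding F_def by (simp add: card_image card_cartesian_product)
  qed
  have FA: "F \<subseteq> all_pairs n" using S by (auto simp: F_def all_pairs_def card_insert_if)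
  have "expect_subset (all_pairs n) p (\<lambda>R. of_bool (nbhd R S = W))
      \<le> (\<Sum>\<phi>\<in>?I. expect_subset (all_pairs n) p (\<lambda>R. of_bool (T \<phi> \<subseteq> R \<and> R \<inter> F = {})))"
  proof (rule expect_subset_union_bound[OF p finI])
    fix R assume R: "R \<subseteq> all_pairs n" "nbhd R S = W"
    have "\<exists>a. a \<in> S \<and> {a, w} \<in> R" if "w \<in> W" for w
      using that R(2) by (auto simp: nbhd_def)
    then obtain f where f: "\<And>w. w \<in> W \<Longrightarrow> f w \<in> S \<and> {f w, w} \<in> R" by metis
    have "R \<inter> F = {}" using R(2) by (auto simp: F_def nbhd_def)
    moreover have "T (restrict f W) \<subseteq> R" using f by (auto simp: T_def)
    moreover have "restrict f W \<in> ?I" using f by auto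
    ultimately show "\<exists>\<phi>\<in>?I. T \<phi> \<subseteq> R \<and> R \<inter> F = {}" by blast
  qed
  also have "\<dots> = (\<Sum>\<phi>\<in>?I. p ^ card W * (1 - p) ^ (card S * (n - card S - card W)))"
  proof (intro sum.cong refl)
    fix \<phi> assume \<phi>: "\<phi> \<in> ?I"
    have \<phi>S: "\<phi> w \<in> S" "w \<notin> S" "w < n" "\<phi> w < n" if "w \<in> W" for w
      using \<phi> W S that by (auto simp: PiE_iff)
    have "inj_on (\<lambda>w. {\<phi> w, w}) W"
    proof (rule inj_onI)
      fix v w assume "v \<in> W" "w \<in> W" "{\<phi> v, v} = {\<phi> w, w}"
      then show "v = w" using \<phi>S(1,2) by (metis doubleton_eq_iff)
    qed
    then have "card (T \<phi>) = card W" unfolding T_def by (rule card_image)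
    moreover have "T \<phi> \<subseteq> all_pairs n"
    proof
      fix e assume "e \<in> T \<phi>"
      then obtain w where w: "w \<in> W" "e = {\<phi> w, w}" by (auto simp: T_def)
      have "\<phi> w \<noteq> w" using \<phi>S[OF w(1)] by metis
      then show "e \<in> all_pairs n" using w \<phi>S[OF w(1)] by (simp add: all_pairs_def)
    qed
    moreover have "T \<phi> \<inter> F = {}"
    proof (rule ccontr)
      assume "T \<phi> \<inter> F \<noteq> {}"
      then obtain w a b where "w \<in> W" "a \<in> S" "b \<in> {..<n} - S - W" "{\<phi> w, w} = {a, b}"
        by (auto simp: T_def F_def)
      then show False using \<phi>S(1,2)[of w] by (auto simp: doubleton_eq_iff)
    qed
    ultimately show "expect_subset (all_pairs n) p (\<lambda>R. of_bool (T \<phi> \<subseteq> R \<and> R \<inter> F = {}))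
        = p ^ card W * (1 - p) ^ (card S * (n - card S - card W))"
      using FA by (simp add: expect_subset_contain_avoid finite_all_pairs cardF)
  qed
  also have "\<dots> = (real (card S) * p) ^ card W * (1 - p) ^ (card S * (n - card S - card W))"
    using fin by (simp add: card_PiE power_mult_distrib)
  finally show ?thesis .
qed

text \<open>The exact neighbourhoods of size \<open>j \<le> 2 s\<close> contribute at most
  \<open>(n p s)^j / j!\<close>; as \<open>n p \<ge> 1\<close>, the factor
  \<open>(n p)^(2 s)\<close> can be taken out, and the rest sums to at most \<open>exp s\<close>.
  The form of an \<open>s\<close>-th power prepares a geometric series over
  \<open>s\<close>.\<close>

lemma prob_small_nbhd:
  assumes p: "0 \<le> p" "p \<le> 1" and S: "S \<subseteq> {..<n}" and L: "real n * p \<ge> 1"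
    and s: "card S = s" "3 * s \<le> n"
  shows "expect_subset (all_pairs n) p (\<lambda>R. of_bool (card (nbhd R S) \<le> 2 * s))
    \<le> ((real n * p)\<^sup>2 * exp 1 * exp (- p * (real n - 3 * real s))) ^ s"
proof -
  let ?X = "{..<n} - S"
  let ?I = "{W. W \<subseteq> ?X \<and> card W \<le> 2 * s}"
  have finI: "finite ?I" by (rule finite_subset[of _ "Pow ?X"]) auto
  have "expect_subset (all_pairs n) p (\<lambda>R. of_bool (card (nbhd R S) \<le> 2 * s))
      \<le> (\<Sum>W\<in>?I. expect_subset (all_pairs n) p (\<lambda>R. of_bool (nbhd R S = W)))"
  proof (rule expect_subset_union_bound[OF p finI])
    fix R assume R: "R \<subseteq> all_pairs n" "card (nbhd R S) \<le> 2 * s"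
    have "nbhd R S \<subseteq> ?X" using R(1) by (auto simp: nbhd_def all_pairs_def)
    then show "\<exists>W\<in>?I. nbhd R S = W" using R(2) by blast
  qed
  also have "\<dots> \<le> (\<Sum>W\<in>?I. (real s * p) ^ card W * exp (- p * (real n - 3 * real s)) ^ s)"
  proof (rule sum_mono)
    fix W assume W: "W \<in> ?I"
    have "expect_subset (all_pairs n) p (\<lambda>R. of_bool (nbhd R S = W))
        \<le> (real s * p) ^ card W * (1 - p) ^ (s * (n - s - card W))"
      using prob_nbhd_eq[OF p S, of W] W s by simp
    also have "\<dots> \<le> (real s * p) ^ card W * exp (- p * real (s * (n - s - card W)))"
      using p by (intro mult_left_mono one_minus_power_le_exp) auto
    also have "exp (- p * real (s * (n - s - card W))) \<le> exp (- p * (real n - 3 * real s)) ^ s"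
    proof -
      have "real n - 3 * real s \<le> real (n - s - card W)" using W s by auto
      then have "real s * (p * (real n - 3 * real s)) \<le> real s * (p * real (n - s - card W))"
        using p by (intro mult_left_mono) auto
      then show ?thesis unfolding exp_of_nat_mult[symmetric] of_nat_mult by (simp add: mult.left_commute)
    qed
    finally show "expect_subset (all_pairs n) p (\<lambda>R. of_bool (nbhd R S = W))
        \<le> (real s * p) ^ card W * exp (- p * (real n - 3 * real s)) ^ s"
      using p by (simp add: mult_left_mono)
  qed
  also have "\<dots> = (\<Sum>W\<in>?I. (real s * p) ^ card W) * exp (- p * (real n - 3 * real s)) ^ s"
    by (simp add: sum_distrib_right)
  also have "\<dots> \<le> ((real n * p)\<^sup>2 * exp 1) ^ s * exp (- p * (real n - 3 * real s)) ^ s"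
  proof (rule mult_right_mono)
    have "(\<Sum>W\<in>?I. (real s * p) ^ card W) \<le> (\<Sum>j\<le>2 * s. (real (card ?X) * (real s * p)) ^ j / fact j)"
      using p by (intro sum_small_subsets_le) auto
    also have "\<dots> \<le> (\<Sum>j\<le>2 * s. (real n * p) ^ (2 * s) * (real s ^ j / fact j))"
    proof (rule sum_mono)
      fix j assume j: "j \<in> {..2 * s}"
      have "card ?X \<le> card {..<n}" by (intro card_mono) auto
      then have "real (card ?X) * (real s * p) \<le> real n * (real s * p)" using p by (intro mult_right_mono) auto
      then have "(real (card ?X) * (real s * p)) ^ j \<le> (real n * p * real s) ^ j"
        using p by (intro power_mono) (auto simp: mult_ac)
      also have "\<dots> = (real n * p) ^ j * real s ^ j" by (simp add: power_mult_distrib)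
      also have "\<dots> \<le> (real n * p) ^ (2 * s) * real s ^ j"
        using L j by (intro mult_right_mono power_increasing) auto
      finally show "(real (card ?X) * (real s * p)) ^ j / fact j \<le> (real n * p) ^ (2 * s) * (real s ^ j / fact j)"
        by (simp add: divide_right_mono)
    qed
    also have "\<dots> = (real n * p) ^ (2 * s) * (\<Sum>j\<le>2 * s. real s ^ j / fact j)" by (simp add: sum_distrib_left)
    also have "\<dots> \<le> (real n * p) ^ (2 * s) * exp (real s)"
      using L by (intro mult_left_mono sum_exp_series_le) auto
    also have "\<dots> = ((real n * p)\<^sup>2 * exp 1) ^ s"
      by (simp add: power_mult power_mult_distrib exp_of_nat_mult[symmetric])
    finally show "(\<Sum>W\<in>?I. (real s * p) ^ card W) \<le> ((real n * p)\<^sup>2 * exp 1) ^ s" .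
  qed auto
  finally show ?thesis by (simp add: power_mult_distrib)
qed

lemma binomial_le_exp_pow:
  assumes "s > 0"
  shows "real (n choose s) \<le> (exp 1 * (real n / real s)) ^ s"
proof -
  have "real s ^ s / fact s \<le> exp (real s)"
    using sum_exp_series_le[of "real s" "{s}"] by simp
  then have "1 / fact s \<le> exp (real s) / real s ^ s" using assms by (simp add: field_simps)
  then have "real n ^ s * (1 / fact s) \<le> real n ^ s * (exp (real s) / real s ^ s)"
    by (intro mult_left_mono) auto
  with binomial_le_pow_div_fact[of n s]
  have "real (n choose s) \<le> real n ^ s * (exp (real s) / real s ^ s)" by simp
  also have "\<dots> = (exp 1 * (real n / real s)) ^ s"
    by (simp add: power_mult_distrib power_divide exp_of_nat_mult[symmetric])
  finally show ?thesis .
qed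

text \<open>Choosing the set costs a further \<open>(exp 1 * n / s)^s\<close>, whence
  \<open>exp 2\<close> in the base.\<close>

lemma prob_not_expander:
  assumes p: "0 \<le> p" "p \<le> 1" and L: "real n * p \<ge> 1"
  shows "expect_subset (all_pairs n) p (\<lambda>R. of_bool (\<not> expander n R))
    \<le> (\<Sum>s=1..n div 4. (exp 2 * (real n / real s) * (real n * p)\<^sup>2 * exp (- p * (real n - 3 * real s))) ^ s)"
proof -
  let ?P = "\<lambda>s. {S. S \<subseteq> {..<n} \<and> card S = s}"
  define B where "B s = (real n * p)\<^sup>2 * exp 1 * exp (- p * (real n - 3 * real s))" for s
  have finP: "finite (?P s)" for s by (rule finite_subset[of _ "Pow {..<n}"]) auto
  have "expect_subset (all_pairs n) p (\<lambda>R. of_bool (\<not> expander n R))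
      \<le> (\<Sum>s\<in>{1..n div 4}. expect_subset (all_pairs n) p (\<lambda>R. of_bool (\<exists>S\<in>?P s. card (nbhd R S) \<le> 2 * s)))"
  proof (rule expect_subset_union_bound[OF p])
    fix R assume R: "R \<subseteq> all_pairs n" "\<not> expander n R"
    then obtain S where S: "S \<subseteq> {..<n}" "S \<noteq> {}" "card S \<le> n div 4" "card (nbhd R S) \<le> 2 * card S"
      unfolding expander_def by (auto simp: not_less)
    have "finite S" using S(1) finite_subset by blast
    then have "card S \<ge> 1" using S(2) by (simp add: Suc_le_eq card_gt_0_iff)
    then show "\<exists>s\<in>{1..n div 4}. \<exists>S\<in>?P s. card (nbhd R S) \<le> 2 * s" using S by (intro bexI[of _ "card S"]) auto
  qed simp
  also have "\<dots> \<le> (\<Sum>s=1..n div 4. (exp 2 * (real n / real s) * (real n * p)\<^sup>2 * exp (- p * (real n - 3 * real s))) ^ s)"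
  proof (rule sum_mono)
    fix s assume s: "s \<in> {1..n div 4}"
    have "expect_subset (all_pairs n) p (\<lambda>R. of_bool (\<exists>S\<in>?P s. card (nbhd R S) \<le> 2 * s))
      \<le> (\<Sum>S\<in>?P s. expect_subset (all_pairs n) p (\<lambda>R. of_bool (card (nbhd R S) \<le> 2 * s)))"
      by (rule expect_subset_union_bound[OF p finP])
    also have "\<dots> \<le> (\<Sum>S\<in>?P s. B s ^ s)"
      unfolding B_def using s by (intro sum_mono prob_small_nbhd p L) auto
    also have "\<dots> = real (n choose s) * B s ^ s" using n_subsets[of "{..<n}" s] by simp
    also have "\<dots> \<le> (exp 1 * (real n / real s)) ^ s * B s ^ s"
      using s by (intro mult_right_mono binomial_le_exp_pow) (auto simp: B_def)
    also have "\<dots> = (exp 2 * (real n / real s) * (real n * p)\<^sup>2 * exp (- p * (real n - 3 * real s))) ^ s"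
    proof -
      have "exp 2 = exp 1 * exp (1::real)" by (simp add: exp_add[symmetric])
      then show ?thesis unfolding B_def power_mult_distrib[symmetric] by (simp add: mult_ac)
    qed
    finally show "expect_subset (all_pairs n) p (\<lambda>R. of_bool (\<exists>S\<in>?P s. card (nbhd R S) \<le> 2 * s))
      \<le> (exp 2 * (real n / real s) * (real n * p)\<^sup>2 * exp (- p * (real n - 3 * real s))) ^ s" .
  qed
  finally show ?thesis .
qed

section \<open>The two regimes\<close>

lemma hamiltonian_mono: "E \<subseteq> E' \<Longrightarrow> hamiltonian n E \<Longrightarrow> hamiltonian n E'"
  unfolding hamiltonian_def by (meson subsetD)

text \<open>Coupling by sprinkling: \<open>x = (q - p) / (1 - p)\<close> solves
  \<open>q = p + x - p x\<close>, so the denser random set is the sparser one with further elements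
  added. For \<open>p = 1\<close> also \<open>q = 1\<close>.\<close>

lemma expect_subset_antimono:
  assumes "finite A" "0 \<le> p" "p \<le> q" "q \<le> 1" and f: "\<And>R S. R \<subseteq> A \<Longrightarrow> S \<subseteq> A \<Longrightarrow> f (R \<union> S) \<le> f R"
  shows "expect_subset A q f \<le> expect_subset A p f"
proof (cases "p = 1")
  case True
  then show ?thesis using assms by simp
next
  case False
  then have p1: "p < 1" using assms by simp
  define x where "x = (q - p) / (1 - p)"
  have x: "0 \<le> x" "x \<le> 1" using p1 assms by (auto simp: x_def)
  have "x * (1 - p) = q - p" using p1 by (simp add: x_def)
  then have "q = p + x - p * x" by (simp add: algebra_simps)
  then have "expect_subset A q f = expect_subset A p (\<lambda>R. expect_subset A x (\<lambda>S. f (R \<union> S)))"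
    using expect_subset_union[OF assms(1), of p x f] by simp
  also have "\<dots> \<le> expect_subset A p (\<lambda>R. expect_subset A x (\<lambda>S. f R))"
    using assms x by (intro expect_subset_mono f) auto
  also have "\<dots> = expect_subset A p f" using assms(1) by (simp add: expect_subset_const)
  finally show ?thesis .
qed

lemma ln_le_pow2: "x \<le> 2 ^ k \<Longrightarrow> 0 < x \<Longrightarrow> ln x \<le> real k"
proof -
  assume x: "x \<le> 2 ^ k" "0 < (x::real)"
  then have "ln x \<le> ln (2 ^ k)" by simp
  also have "\<dots> = real k * ln 2" by (simp add: ln_realpow)
  also have "\<dots> \<le> real k * 1" using ln_2_less_1 by (intro mult_left_mono) auto
  finally show ?thesis by simp
qed

text \<open>In terms of \<open>N = sqrt n\<close>, \<open>\<rho> = sqrt r\<close> and \<open>l = sqrt (ln n)\<close> one has \<open>p = 2160 N^3 l / \<rho>^6\<close>,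
  \<open>D = 54 N^2 / \<rho>\<close> defects to repair, and the exponent is at most \<open>13 D z - 20 D z\<close> with \<open>z = N l / \<rho>\<close>.\<close>
lemma regular_regime:
  assumes G: "regular_graph n r E" and r: "r > 0" and n: "n \<ge> 3"
    and p: "p = 2160 * sqrt (real n ^ 3 * ln (real n)) / real r ^ 3" "p \<le> 1"
  shows "expect_subset (all_pairs n) p (\<lambda>R. of_bool (\<not> hamiltonian n (E \<union> R))) \<le> exp (- sqrt (ln (real n)))"
proof -
  define N where "N = sqrt (real n)"
  define \<rho> where "\<rho> = sqrt (real r)"
  define l where "l = sqrt (ln (real n))"
  have N2: "real n = N\<^sup>2" by (simp add: N_def)
  have r2: "real r = \<rho>\<^sup>2" by (simp add: \<rho>_def)
  have rho: "\<rho> \<ge> 1" using r by (simp add: \<rho>_def)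
  have "r \<le> n" using regular_graph_degree_le[OF G] n by simp
  then have rN: "\<rho> \<le> N" by (simp add: \<rho>_def N_def)
  have "exp 1 \<le> (3::real)" by (rule exp_le)
  then have "ln (exp 1) \<le> ln (real n)" using n by (subst ln_le_cancel_iff) auto
  then have l1: "l \<ge> 1" by (simp add: l_def)
  have peq: "p = 2160 * N ^ 3 * l / \<rho> ^ 6"
  proof -
    have "sqrt (real n ^ 3 * ln (real n)) = N ^ 3 * l"
      by (simp add: N_def l_def real_sqrt_mult real_sqrt_power)
    then show ?thesis unfolding p(1) r2 by (simp add: power_mult[symmetric])
  qed
  have p0: "p \<ge> 0" unfolding peq using rN rho l1 by simp
  \<comment> \<open>\<open>54\<close> is the \<open>53\<close> of
    \<open>regular_graph_ordering\<close> plus one for the closing pair. The next line takes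
    \<open>t = n^2 p / D\<close>, where \<open>2160 = 40 * 54\<close>; the same constant makes the
    booster term \<open>p r^2 / 2\<close> equal to \<open>20 D z\<close>.\<close>
  define D where "D = 54 * (N\<^sup>2 / \<rho>)"
  define t where "t = 40 * (N / \<rho>) ^ 5 * l"
  define z where "z = N / \<rho> * l"
  have a: "N / \<rho> \<ge> 1" using rN rho by simp
  have z: "z \<ge> l" "z \<ge> N / \<rho>" "z \<ge> 1"
  proof -
    show zl: "z \<ge> l" unfolding z_def using mult_right_mono[OF a, of l] l1 by simp
    show "z \<ge> N / \<rho>" unfolding z_def using mult_left_mono[OF l1, of "N / \<rho>"] a by simp
    show "z \<ge> 1" using zl l1 by simp
  qed
  have NrN: "N\<^sup>2 / \<rho> \<ge> 1"
  proof -
    have "\<rho> * 1 \<le> N * N" using rN rho by (intro mult_mono) auto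
    then show ?thesis using rho by (simp add: power2_eq_square)
  qed
  obtain zs where zs: "distinct zs" "set zs = {..<n}" "real (defects E zs) \<le> 53 * (N\<^sup>2 / \<rho>)"
    using regular_graph_ordering[OF G r] n unfolding N2[symmetric] \<rho>_def by auto
  have "real (cyc_defects E zs) \<le> real (defects E zs) + 1" by (simp add: cyc_defects_def of_bool_def)
  then have cyc: "real (cyc_defects E zs) \<le> D" using zs(3) NrN unfolding D_def by linarith
  have t1: "t \<ge> 1"
  proof -
    have "1 * 1 * 1 \<le> 40 * (N / \<rho>) ^ 5 * l" using a l1 by (intro mult_mono one_le_power) auto
    then show ?thesis by (simp add: t_def)
  qed
  have tD: "(real n)\<^sup>2 / 2 * p \<le> t * D"
  proof -
    have "t * D = 2160 * N ^ 7 * l / \<rho> ^ 6"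
      unfolding t_def D_def using rho by (simp add: power_divide) (simp add: field_simps eval_nat_numeral)
    moreover have "(real n)\<^sup>2 / 2 * p = 1080 * N ^ 7 * l / \<rho> ^ 6"
      unfolding peq N2 using rho by (simp add: field_simps eval_nat_numeral)
    moreover have "1080 * N ^ 7 * l / \<rho> ^ 6 \<le> 2160 * N ^ 7 * l / \<rho> ^ 6"
      using rN rho l1 by (intro divide_right_mono mult_right_mono) auto
    ultimately show ?thesis by linarith
  qed
  have "expect_subset (all_pairs n) p (\<lambda>R. of_bool (\<not> hamiltonian n (E \<union> R)))
      \<le> exp (D * (1 + ln t) - p * (real r)\<^sup>2 / 2)"
    using n zs
    by (intro rotatable_non_hamiltonian_prob[OF regular_graph_rotatable[OF G] _ _ cyc p0 p(2) t1 tD])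
      (auto simp: vertex_ordering_def)
  also have "\<dots> \<le> exp (- l)"
  proof -
    have "ln t = ln 40 + 5 * ln (N / \<rho>) + ln l"
      unfolding t_def using a l1 rho rN by (simp add: ln_mult ln_realpow)
    moreover have "ln (40::real) \<le> 6" using ln_le_pow2[of 40 6] by simp
    moreover have "ln (N / \<rho>) \<le> z" using ln_le_minus_one[of "N / \<rho>"] a z by linarith
    moreover have "ln l \<le> z" using ln_le_minus_one[of l] l1 z by linarith
    \<comment> \<open>The constants \<open>1 + 6\<close> are at most \<open>7 z\<close>, and the six
      logarithms, five of \<open>N / \<rho>\<close> and one of \<open>l\<close>, are at most
      \<open>z\<close> each. The \<open>7 D z\<close> left over from the booster term exceed
      \<open>l\<close>.\<close>
    ultimately have "1 + ln t \<le> 13 * z" using z by linarith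
    moreover have D1: "D \<ge> 1" using NrN by (simp add: D_def)
    ultimately have "D * (1 + ln t) \<le> D * (13 * z)" by (intro mult_left_mono) auto
    moreover have "p * (real r)\<^sup>2 / 2 = D * (20 * z)"
      unfolding peq r2 D_def z_def using rho by (simp add: field_simps eval_nat_numeral)
    moreover have "D * z \<ge> l" using mult_mono[OF D1 z(1)] l1 D1 by simp
    ultimately have "D * (1 + ln t) - p * (real r)\<^sup>2 / 2 \<le> - l" using l1 by (simp add: algebra_simps)
    then show ?thesis by simp
  qed
  finally show ?thesis by (simp add: l_def)
qed

section \<open>The random graph above the Hamiltonicity threshold\<close>

definition expansion_error :: "nat \<Rightarrow> real" where
  "expansion_error n = 4 * exp 408 * (ln (real n))\<^sup>2 * exp (- sqrt (ln (real n)))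
     + 4 * exp 102 * (ln (real n)) ^ 3 * exp (- ln (real n) / 4)"

lemma expansion_error_tendsto: "expansion_error \<longlonglongrightarrow> 0"
proof -
  have "(\<lambda>n. 4 * c * (ln (real n))\<^sup>2 * exp (- sqrt (ln (real n)))
     + 4 * d * (ln (real n)) ^ 3 * exp (- ln (real n) / 4)) \<longlonglongrightarrow> 0" for c d :: real
    by real_asymp
  then show ?thesis unfolding expansion_error_def .
qed

text \<open>For \<open>s * x \<le> n\<close> the correction \<open>3 s \<Lambda> / n\<close> is at
  most \<open>6\<close>, so \<open>exp (- x) = 1 / n\<close> cancels \<open>n / s\<close> and
  \<open>exp (- sqrt x)\<close> remains against \<open>x^2\<close>; here
  \<open>408 = 2 + 400 + 6\<close>. For larger sets \<open>n / s \<le> x\<close> is only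
  logarithmic, so the quarter of the exponent guaranteed by \<open>4 s \<le> n\<close> suffices;
  here \<open>102 = 2 + 400 / 4\<close>.\<close>

lemma expansion_error_bound:
  fixes n s :: nat
  defines "x \<equiv> ln (real n)"
  assumes x: "x \<ge> 401" and s: "1 \<le> s" "s \<le> n div 4" and \<Lambda>: "\<Lambda> = x + sqrt x - 400"
  shows "exp 2 * (real n / real s) * \<Lambda>\<^sup>2 * exp (- \<Lambda> * (1 - 3 * (real s / real n))) \<le> expansion_error n"
proof -
  have n: "n > 0" using s by simp
  have sqx: "sqrt x * sqrt x = x" using x by simp
  have "sqrt x \<ge> 1" using x by simp
  then have sx: "sqrt x \<le> x" using mult_left_mono[of 1 "sqrt x" "sqrt x"] sqx by simp
  have L: "1 \<le> \<Lambda>" "\<Lambda> \<le> 2 * x" "x - 400 \<le> \<Lambda>" using x sx \<open>sqrt x \<ge> 1\<close> unfolding \<Lambda> by linarith+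
  have L2: "\<Lambda>\<^sup>2 \<le> 4 * x\<^sup>2"
  proof -
    have "\<Lambda>\<^sup>2 \<le> (2 * x)\<^sup>2" using L by (intro power_mono) auto
    then show ?thesis by (simp add: power_mult_distrib)
  qed
  have expx: "exp x = real n" using n by (simp add: x_def)
  let ?a = "4 * exp 408 * x\<^sup>2 * exp (- sqrt x)"
  let ?b = "4 * exp 102 * x ^ 3 * exp (- x / 4)"
  have pos: "?a \<ge> 0" "?b \<ge> 0" using x by simp_all
  have E: "expansion_error n = ?a + ?b" by (simp add: expansion_error_def x_def)
  show ?thesis
  proof (cases "real s * x \<le> real n")
    case True
    have "real s / real n * \<Lambda> \<le> real s / real n * (2 * x)" using L by (intro mult_left_mono) auto
    also have "\<dots> \<le> 2" using True n by (simp add: field_simps)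
    finally have "real s / real n * \<Lambda> \<le> 2" .
    moreover have "- \<Lambda> * (1 - 3 * (real s / real n)) = - \<Lambda> + 3 * (real s / real n * \<Lambda>)"
      by (simp add: algebra_simps)
    ultimately have "- \<Lambda> * (1 - 3 * (real s / real n)) \<le> - \<Lambda> + 6" by linarith
    then have "exp (- \<Lambda> * (1 - 3 * (real s / real n))) \<le> exp (- \<Lambda> + 6)" by simp
    also have "- \<Lambda> + 6 = 406 + (- sqrt x) + (- x)" unfolding \<Lambda> by simp
    also have "exp \<dots> = exp 406 * exp (- sqrt x) / real n"
      by (simp only: exp_add exp_minus expx) (simp add: divide_inverse)
    finally have 1: "exp (- \<Lambda> * (1 - 3 * (real s / real n))) \<le> exp 406 * exp (- sqrt x) / real n" .
    have 2: "real n / real s \<le> real n" using s(1) mult_left_mono[of 1 "real s" "real n"] by (simp add: divide_le_eq)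
    have "exp 2 * (real n / real s) * \<Lambda>\<^sup>2 * exp (- \<Lambda> * (1 - 3 * (real s / real n)))
        \<le> exp 2 * real n * (4 * x\<^sup>2) * (exp 406 * exp (- sqrt x) / real n)"
      by (intro mult_mono 1 2 L2 order_refl) auto
    also have "\<dots> = ?a"
    proof -
      have "exp 408 = exp 2 * exp (406::real)" by (simp add: exp_add[symmetric])
      then show ?thesis using n by simp
    qed
    finally show ?thesis unfolding E using pos by linarith
  next
    case False
    have 2: "real n / real s \<le> x" using False s by (simp add: divide_le_eq mult.commute)
    have "4 * s \<le> n" using s by simp
    then have "real (4 * s) \<le> real n" by (rule of_nat_mono)
    then have "1 - 3 * (real s / real n) \<ge> 1 / 4" using n by (simp add: field_simps)
    then have "\<Lambda> * (1 / 4) \<le> \<Lambda> * (1 - 3 * (real s / real n))" using L by (intro mult_left_mono) auto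
    then have "- \<Lambda> * (1 - 3 * (real s / real n)) \<le> 100 + - x / 4"
      using L(3) unfolding mult_minus_left by linarith
    then have "exp (- \<Lambda> * (1 - 3 * (real s / real n))) \<le> exp (100 + - x / 4)" by simp
    also have "\<dots> = exp 100 * exp (- x / 4)" by (rule exp_add)
    finally have 1: "exp (- \<Lambda> * (1 - 3 * (real s / real n))) \<le> exp 100 * exp (- x / 4)" .
    have "exp 2 * (real n / real s) * \<Lambda>\<^sup>2 * exp (- \<Lambda> * (1 - 3 * (real s / real n)))
        \<le> exp 2 * x * (4 * x\<^sup>2) * (exp 100 * exp (- x / 4))"
      using x by (intro mult_mono 1 2 L2 order_refl) auto
    also have "\<dots> = ?b"
    proof -
      have "exp 102 = exp 2 * exp (100::real)" by (simp add: exp_add[symmetric])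
      then show ?thesis by (simp add: power2_eq_square power3_eq_cube)
    qed
    finally show ?thesis unfolding E using pos by linarith
  qed
qed

lemma sum_powers_le:
  fixes b :: real
  assumes "0 \<le> b" "b \<le> 1 / 2"
  shows "(\<Sum>s=1..m. b ^ s) \<le> 2 * b"
proof -
  have "(\<Sum>s=1..m. b ^ s) \<le> (2 - 2 * (1 / 2) ^ m) * b"
  proof (induction m)
    case (Suc m)
    have "b ^ Suc m \<le> (1 / 2) ^ m * b" using assms by (simp add: mult.commute mult_left_mono power_mono)
    moreover have "(\<Sum>s=1..Suc m. b ^ s) = (\<Sum>s=1..m. b ^ s) + b ^ Suc m" by simp
    moreover have "(2 - 2 * (1 / 2) ^ Suc m) * b = (2 - 2 * (1 / 2) ^ m) * b + (1 / 2) ^ m * b"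
      by (simp add: algebra_simps)
    ultimately show ?case using Suc.IH by linarith
  qed simp
  also have "\<dots> \<le> 2 * b" using assms by (intro mult_right_mono) auto
  finally show ?thesis .
qed

text \<open>With quadratically many boosters the trivial bound of \<open>n\<close> defects is
  affordable. Here \<open>t = 200\<close>, since \<open>n^2 / 2 * (400 / n) = 200 n\<close>; the
  certificates cost at most \<open>9 n\<close> in the exponent and the boosters save at least
  \<open>25 n / 2\<close>.\<close>

lemma expander_boost:
  assumes exp: "expander n R" and R: "R \<subseteq> all_pairs n" and n: "n \<ge> 400"
  shows "expect_subset (all_pairs n) (400 / real n) (\<lambda>S. of_bool (\<not> hamiltonian n (R \<union> S))) \<le> exp (- real n)"
proof -
  have vo: "vertex_ordering n [0..<n]" by (auto simp: vertex_ordering_def)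
  have "cyc_defects R [0..<n] \<le> n"
    using defects_le_length[of R "[0..<n]"] n by (auto simp: cyc_defects_def of_bool_def)
  then have cyc: "real (cyc_defects R [0..<n]) \<le> real n" by (rule of_nat_mono)
  have "expect_subset (all_pairs n) (400 / real n) (\<lambda>S. of_bool (\<not> hamiltonian n (R \<union> S)))
      \<le> exp (real n * (1 + ln 200) - 400 / real n * (real (n div 4 + 1))\<^sup>2 / 2)"
    using n by (intro rotatable_non_hamiltonian_prob[OF expander_rotatable[OF exp R] _ vo cyc])
      (auto simp: power2_eq_square)
  also have "\<dots> \<le> exp (- real n)"
  proof -
    have "ln (200::real) \<le> 8" using ln_le_pow2[of 200 8] by simp
    then have "real n * (1 + ln 200) \<le> real n * 9" by (intro mult_left_mono) auto
    moreover have "n \<le> 4 * (n div 4 + 1)" by presburger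
    then have "real n \<le> real (4 * (n div 4 + 1))" by (rule of_nat_mono)
    then have "real n / 4 \<le> real (n div 4 + 1)" by simp
    then have "(real n / 4)\<^sup>2 \<le> (real (n div 4 + 1))\<^sup>2" by (intro power_mono) auto
    then have "400 / real n * (real n / 4)\<^sup>2 \<le> 400 / real n * (real (n div 4 + 1))\<^sup>2"
      by (intro mult_left_mono) auto
    moreover have "400 / real n * (real n / 4)\<^sup>2 = 25 * real n" using n by (simp add: power2_eq_square)
    ultimately show ?thesis by simp
  qed
  finally show ?thesis .
qed

text \<open>The excess \<open>sqrt (ln n)\<close> of \<open>n p\<close> over \<open>ln n\<close> has
  two uses: \<open>400\<close> of it is set aside for the second exposure, and the rest supplies the
  factor \<open>exp (- sqrt (ln n))\<close> that beats the \<open>(ln n)^2\<close> lost on small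
  sets. As \<open>expansion_error n\<close> bounds the base for every set size, the failure
  probabilities sum geometrically.\<close>

lemma random_regime:
  assumes x: "ln (real n) \<ge> 401" and n: "n \<ge> 400" and err: "expansion_error n \<le> 1 / 2"
    and p: "p \<le> 1" "p \<ge> (1 + 1 / sqrt (ln (real n))) * ln (real n) / real n"
  shows "expect_subset (all_pairs n) p (\<lambda>R. of_bool (\<not> hamiltonian n R)) \<le> 2 * expansion_error n + exp (- real n)"
proof -
  define \<Lambda> where "\<Lambda> = ln (real n) + sqrt (ln (real n)) - 400"
  define p1 where "p1 = \<Lambda> / real n"
  define q where "q = 400 / real n"
  let ?A = "all_pairs n"
  have "sqrt (ln (real n)) \<ge> 0" using x by simp
  then have L1: "\<Lambda> \<ge> 1" using x unfolding \<Lambda>_def by linarith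
  have "ln (real n) / sqrt (ln (real n)) = sqrt (ln (real n))" using x by (simp add: real_div_sqrt)
  then have "(1 + 1 / sqrt (ln (real n))) * ln (real n) = \<Lambda> + 400"
    unfolding \<Lambda>_def by (simp add: algebra_simps)
  then have pq: "p1 + q \<le> p" using p(2) by (simp add: p1_def q_def add_divide_distrib)
  have p1: "0 \<le> p1" "p1 \<le> 1" "real n * p1 = \<Lambda>"
  proof -
    show "0 \<le> p1" using L1 by (simp add: p1_def)
    show "p1 \<le> 1" using pq p(1) by (simp add: q_def) (smt (verit) divide_nonneg_nonneg of_nat_0_le_iff)
    show "real n * p1 = \<Lambda>" using n by (simp add: p1_def)
  qed
  have q: "0 \<le> q" "q \<le> 1" using n by (simp_all add: q_def)
  have E0: "expansion_error n \<ge> 0" using x by (simp add: expansion_error_def)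
  have "expect_subset ?A p (\<lambda>R. of_bool (\<not> hamiltonian n R))
      \<le> expect_subset ?A (p1 + q - p1 * q) (\<lambda>R. of_bool (\<not> hamiltonian n R))"
  proof (rule expect_subset_antimono[OF finite_all_pairs])
    have "p1 * q \<le> p1 * 1" using p1 q by (intro mult_left_mono) auto
    then show "0 \<le> p1 + q - p1 * q" using q by simp
    have "p1 * q \<ge> 0" using p1 q by simp
    then show "p1 + q - p1 * q \<le> p" using pq by linarith
    show "of_bool (\<not> hamiltonian n (R \<union> S)) \<le> (of_bool (\<not> hamiltonian n R) :: real)" for R S
      using hamiltonian_mono[of R "R \<union> S" n] by auto
  qed (rule p(1))
  also have "\<dots> = expect_subset ?A p1 (\<lambda>R. expect_subset ?A q (\<lambda>S. of_bool (\<not> hamiltonian n (R \<union> S))))"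
    by (rule expect_subset_union[OF finite_all_pairs, symmetric])
  also have "\<dots> \<le> expect_subset ?A p1 (\<lambda>R. of_bool (\<not> expander n R) + exp (- real n))"
  proof (rule expect_subset_mono[OF p1(1,2)])
    fix R assume R: "R \<subseteq> ?A"
    show "expect_subset ?A q (\<lambda>S. of_bool (\<not> hamiltonian n (R \<union> S))) \<le> of_bool (\<not> expander n R) + exp (- real n)"
    proof (cases "expander n R")
      case True
      then show ?thesis using expander_boost[OF True R n] by (simp add: q_def)
    next
      case False
      have "expect_subset ?A q (\<lambda>S. of_bool (\<not> hamiltonian n (R \<union> S))) \<le> expect_subset ?A q (\<lambda>S. 1)"
        using q by (intro expect_subset_mono) auto
      also have "\<dots> = 1" by (rule expect_subset_const[OF finite_all_pairs])
      finally show ?thesis using False by (simp add: add_increasing2)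
    qed
  qed
  also have "\<dots> = expect_subset ?A p1 (\<lambda>R. of_bool (\<not> expander n R)) + exp (- real n)"
    by (simp add: expect_subset_add expect_subset_const finite_all_pairs)
  also have "expect_subset ?A p1 (\<lambda>R. of_bool (\<not> expander n R)) \<le> 2 * expansion_error n"
  proof -
    have "expect_subset ?A p1 (\<lambda>R. of_bool (\<not> expander n R))
      \<le> (\<Sum>s=1..n div 4. (exp 2 * (real n / real s) * (real n * p1)\<^sup>2 * exp (- p1 * (real n - 3 * real s))) ^ s)"
      using p1 L1 by (intro prob_not_expander) auto
    also have "\<dots> \<le> (\<Sum>s=1..n div 4. expansion_error n ^ s)"
    proof (intro sum_mono power_mono)
      fix s assume s: "s \<in> {1..n div 4}"
      have "- p1 * (real n - 3 * real s) = - \<Lambda> * (1 - 3 * (real s / real n))"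
        using n by (simp add: p1_def field_simps)
      then show "exp 2 * (real n / real s) * (real n * p1)\<^sup>2 * exp (- p1 * (real n - 3 * real s)) \<le> expansion_error n"
        unfolding p1(3) using expansion_error_bound[OF x _ _ \<Lambda>_def, of s] s by simp
    qed auto
    also have "\<dots> \<le> 2 * expansion_error n" by (rule sum_powers_le[OF E0 err])
    finally show ?thesis .
  qed
  finally show ?thesis by simp
qed

theorem theorem6p1:
  shows "\<exists>c::real. c > 0 \<and> (\<exists>eps :: nat \<Rightarrow> real. eps \<longlonglongrightarrow> 0 \<and>
    (\<forall>(G :: nat \<Rightarrow> nat set set) (r :: nat \<Rightarrow> nat) (p :: nat \<Rightarrow> real).
       (\<forall>n. regular_graph n (r n) (G n)) \<longrightarrow>
       (\<forall>n. 0 \<le> p n \<and> p n \<le> 1) \<longrightarrow>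
       (\<forall>\<^sub>F n in sequentially. p n \<ge> ham_threshold c (eps n) n (r n)) \<longrightarrow>
       (\<lambda>n. prob_gnp n (p n) (\<lambda>R. hamiltonian n (G n \<union> R))) \<longlonglongrightarrow> 1))"
proof -
  \<comment> \<open>A null sequence for which \<open>eps n * ln n = sqrt (ln n)\<close> grows faster
    than \<open>ln (ln n)\<close>, as the powers of \<open>ln n\<close> in
    \<open>expansion_error\<close> require.\<close>
  define eps where "eps n = 1 / sqrt (ln (real n))" for n
  have "eps \<longlonglongrightarrow> 0" unfolding eps_def by real_asymp
  moreover have "(\<lambda>n. prob_gnp n (p n) (\<lambda>R. hamiltonian n (G n \<union> R))) \<longlonglongrightarrow> 1"
    if G: "\<forall>n. regular_graph n (r n) (G n)" and p: "\<forall>n. 0 \<le> p n \<and> p n \<le> 1"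
      and thr: "\<forall>\<^sub>F n in sequentially. p n \<ge> ham_threshold 2160 (eps n) n (r n)" for G r p
  proof -
    \<comment> \<open>Which term of the minimum lies below \<open>p n\<close> may vary with
      \<open>n\<close>, so the error covers both regimes at once.\<close>
    define err where "err n = 2 * expansion_error n + exp (- real n) + exp (- sqrt (ln (real n)))" for n
    have "(\<lambda>n. exp (- real n)) \<longlonglongrightarrow> 0" "(\<lambda>n. exp (- sqrt (ln (real n)))) \<longlonglongrightarrow> 0" by real_asymp+
    then have "err \<longlonglongrightarrow> 2 * 0 + 0 + 0"
      unfolding err_def by (intro tendsto_intros expansion_error_tendsto)
    then have lim: "(\<lambda>n. 1 - err n) \<longlonglongrightarrow> 1" using tendsto_diff[OF tendsto_const, of err 0 sequentially 1] by simp
    define fail where "fail n = expect_subset (all_pairs n) (p n) (\<lambda>R. of_bool (\<not> hamiltonian n (G n \<union> R)))" for n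
    have prob: "prob_gnp n (p n) (\<lambda>R. hamiltonian n (G n \<union> R)) = 1 - fail n" for n
    proof -
      have "prob_gnp n (p n) (\<lambda>R. hamiltonian n (G n \<union> R)) + fail n
          = expect_subset (all_pairs n) (p n) (\<lambda>R. 1)"
        unfolding prob_gnp_expect fail_def expect_subset_add[symmetric]
        by (rule arg_cong[where f = "expect_subset (all_pairs n) (p n)"]) auto
      then show ?thesis by (simp add: expect_subset_const finite_all_pairs)
    qed
    have fail0: "fail n \<ge> 0" for n
      unfolding fail_def expect_subset_def using p by (intro sum_nonneg mult_nonneg_nonneg) auto
    have "\<forall>\<^sub>F n in sequentially. ln (real n) \<ge> 401" by real_asymp
    moreover have "\<forall>\<^sub>F n in sequentially. n \<ge> 400" by (rule eventually_ge_at_top)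
    moreover have "\<forall>\<^sub>F n in sequentially. expansion_error n < 1 / 2"
      using expansion_error_tendsto by (rule order_tendstoD) simp
    ultimately have "\<forall>\<^sub>F n in sequentially. fail n \<le> err n"
      using thr
    proof eventually_elim
      case (elim n)
      have E0: "expansion_error n \<ge> 0" using elim(1) by (simp add: expansion_error_def)
      consider "p n \<ge> (1 + eps n) * ln (real n) / real n"
        | "r n > 0" "p n \<ge> 2160 * sqrt (real n ^ 3 * ln (real n)) / real (r n) ^ 3"
        using elim(4) by (auto simp: ham_threshold_def min_le_iff_disj split: if_splits)
      then show ?case
      proof cases
        case 1
        have "fail n \<le> expect_subset (all_pairs n) (p n) (\<lambda>R. of_bool (\<not> hamiltonian n R))"
          unfolding fail_def using p hamiltonian_mono[of _ "G n \<union> _" n]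
          by (intro expect_subset_mono) auto
        also have "\<dots> \<le> 2 * expansion_error n + exp (- real n)"
          using elim p 1 by (intro random_regime) (auto simp: eps_def)
        finally show ?thesis unfolding err_def by (simp add: add_increasing2)
      next
        case 2
        let ?p = "2160 * sqrt (real n ^ 3 * ln (real n)) / real (r n) ^ 3"
        \<comment> \<open>\<open>regular_regime\<close> treats the threshold value itself; since
          Hamiltonicity is monotone, a larger \<open>p n\<close> can only lower the failure
          probability.\<close>
        have "fail n \<le> expect_subset (all_pairs n) ?p (\<lambda>R. of_bool (\<not> hamiltonian n (G n \<union> R)))"
          unfolding fail_def
        proof (rule expect_subset_antimono[OF finite_all_pairs _ 2(2)])
          show "0 \<le> ?p" using elim(1) by simp
          show "p n \<le> 1" using p by simp
          show "of_bool (\<not> hamiltonian n (G n \<union> (R \<union> S))) \<le> (of_bool (\<not> hamiltonian n (G n \<union> R)) :: real)" for R S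
            using hamiltonian_mono[of "G n \<union> R" "G n \<union> (R \<union> S)" n] by auto
        qed
        also have "\<dots> \<le> exp (- sqrt (ln (real n)))"
        proof (rule regular_regime[OF spec[OF G] 2(1) _ refl])
          show "?p \<le> 1" using 2(2) p order_trans by blast
        qed (use elim(2) in simp)
        finally show ?thesis unfolding err_def using E0 by (simp add: add_increasing)
      qed
    qed
    then have "\<forall>\<^sub>F n in sequentially. 1 - err n \<le> prob_gnp n (p n) (\<lambda>R. hamiltonian n (G n \<union> R))"
      by eventually_elim (simp add: prob)
    moreover have "\<forall>\<^sub>F n in sequentially. prob_gnp n (p n) (\<lambda>R. hamiltonian n (G n \<union> R)) \<le> 1"
      using fail0 by (simp add: prob)
    ultimately show ?thesis using lim by (rule tendsto_sandwich[OF _ _ _ tendsto_const])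
  qed
  ultimately show ?thesis by (intro exI[of _ 2160] exI[of _ eps] conjI) auto
qed

end
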